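(* Let $p(\rho)=\rho^2$ (that is, $\gamma=2$, with specific internal energy $e(\rho)=\rho$), and consider the Riemann initial value problem for the two-dimensional isentropic compressible Euler system with any data $(\rho_\pm,(0,v_\pm))$ such that $\rho_\pm>0$, $v_->v_+$ and $$(v_--v_+)^2\rho_+\rho_--(\rho_+-\rho_-)\big(p(\rho_+)-p(\rho_-)\big)>0 .$$ Let $I^*=[\rho^*,\rho_m]$ be the interval specified in the context, where $\rho_m$ is the density of the intermediate state of the 2-shock solution. Let $S$ be the set consisting of the 2-shock solution, of all convex integration solutions, and of all hybrid solutions arising from admissible fan sub-solutions with parameters $(\rho_1,\varepsilon_2)$, with $\rho_1\in I^*$ and any $\varepsilon_2>0$. Then the 2-shock solution is sARAC-admissible in $S$ and strictly LAAP$_0$-admissible in $S$.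
   Context: **Euler system.** For $(t,x)\in(0,\infty)\times\mathbb R^2$, with density $\rho>0$ and velocity $v\in\mathbb R^2$: $$\partial_t\rho+\operatorname{div}_x(\rho v)=0,\qquad \partial_t(\rho v)+\operatorname{div}_x(\rho v\otimes v)+\nabla_x p(\rho)=0,$$ with initial data $(\rho_-,(0,v_-))$ for $x_2<0$ and $(\rho_+,(0,v_+))$ for $x_2>0$, where $\rho_\pm>0$, $v_\pm\in\mathbb R$ are constants. Weak solutions are understood in the sense of distributions. The specific internal energy $e$ satisfies $e'(\rho)=p(\rho)/\rho^2$; here $e(\rho)=\rho$. A weak solution is entropic if, in the sense of distributions, $\partial_t\big(\rho e(\rho)+\tfrac12\rho|v|^2\big)+\operatorname{div}_x\big[(\rho e(\rho)+\tfrac12\rho|v|^2+p(\rho))v\big]\le 0$. All solutions considered are entropic weak solutions with the given initial data. **2-shock solution.** Under the stated conditions on the data there is a unique self-similar entropic solution depending on $x_2/t$ only; it is equal to $(\rho_-,(0,v_-))$ for $x_2<\nu_-t$, to $(\rho_m,(0,v_m))$ for $\nu_-t<x_2<\nu_+t$, and to $(\rho_+,(0,v_+))$ for $x_2>\nu_+t$, where $\rho_m>\max(\rho_-,\rho_+)$ and the constants $\rho_m,v_m,\nu_-<\nu_+$ are determined by the Rankine–Hugoniot conditions. It is called the 2-shock solution. **Fan sub-solutions.** For real $\nu_-<\nu_+$ put $P_-=\{t>0,\ x_2<\nu_-t\}$, $P_1=\{t>0,\ \nu_-t<x_2<\nu_+t\}$, $P_+=\{t>0,\ x_2>\nu_+t\}$.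 Let $S_0^{2\times2}$ be the set of symmetric trace-free $2\times 2$ matrices. A fan sub-solution is a triple $(\bar\rho,\bar v,\bar u)$ with values in $(0,\infty)\times\mathbb R^2\times S_0^{2\times2}$, for some $\nu_-<\nu_+$, such that: (i) it equals the constants $(\rho_-,\mathbf v_-,u_-)$, $(\rho_1,\mathbf v_1,u_1)$, $(\rho_+,\mathbf v_+,u_+)$ on $P_-,P_1,P_+$ respectively, where $\mathbf v_\pm=(0,v_\pm)$, $u_\pm=\mathbf v_\pm\otimes \mathbf v_\pm-\tfrac12|\mathbf v_\pm|^2\mathrm{Id}$ and $\rho_1>0$; (ii) there is a constant $C>0$ with $\mathbf v_1\otimes \mathbf v_1-u_1<\tfrac C2\mathrm{Id}$ (as symmetric matrices); (iii) in the sense of distributions (with the Riemann initial data) $\partial_t\bar\rho+\operatorname{div}_x(\bar\rho\bar v)=0$ and $\partial_t(\bar\rho\bar v)+\operatorname{div}_x(\bar\rho\bar u)+\nabla_x\big(p(\bar\rho)+\tfrac12(C\rho_1\mathbf 1_{P_1}+\bar\rho|\bar v|^2\mathbf 1_{P_+\cup P_-})\big)=0$. It is admissible if in addition, in the sense of distributions, $$\partial_t(\bar\rho e(\bar\rho))+\operatorname{div}_x[(\bar\rho e(\bar\rho)+p(\bar\rho))\bar v]+\partial_t\big(\tfrac12\bar\rho|\bar v|^2\mathbf 1_{P_+\cup P_-}+\tfrac12\rho_1C\mathbf 1_{P_1}\big)+\operatorname{div}_x\big((\tfrac12\bar\rho|\bar v|^2\mathbf 1_{P_+\cup P_-}+\tfrac12\rho_1C\mathbf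 1_{P_1})\bar v\big)\le0 .$$ The Rankine–Hugoniot conditions force $\mathbf v_1=(0,\beta)$ and $u_1=\operatorname{diag}(g,-g)$. Put $\varepsilon_1=\tfrac C2-g-\beta^2$ and $\varepsilon_2=\tfrac C2+g$, so that $C=\beta^2+\varepsilon_1+\varepsilon_2$ and (ii) means $\varepsilon_1,\varepsilon_2>0$. The Rankine–Hugoniot conditions are then $$\nu_\pm(\rho_\pm-\rho_1)=\rho_\pm v_\pm-\rho_1\beta,\qquad \nu_\pm(\rho_\pm v_\pm-\rho_1\beta)=\rho_\pm v_\pm^2-\rho_1(\beta^2+\varepsilon_1)+p(\rho_\pm)-p(\rho_1),$$ and with $\nu_-<\nu_+$ they determine $\nu_\pm,\beta,\varepsilon_1$ as functions of $\rho_1$, so fan sub-solutions are parameterised by $(\rho_1,\varepsilon_2)$. At $\rho_1=\rho_m$ one has $\beta=v_m$, $\varepsilon_1=0$ and $\nu_\pm$ are the 2-shock speeds. $I^*=[\rho^*,\rho_m]$, with $\max(\rho_-,\rho_+)<\rho^*<\rho_m$ depending on the Riemann data, is an interval on which positive values of $\varepsilon_2$ are allowed by admissibility. **Convex integration solutions.** Given an admissible fan sub-solution, a convex integration solution is $(\bar\rho,\bar v+v)$ where $(v,u)$ is a bounded map with values in $\mathbb R^2\times S_0^{2\times2}$ such that, with $\Lambda=P_1$: $(v,u)=0$ outside $\Lambda$; $\operatorname{div}_xv=0$ and $\partial_tv+\operatorname{div}_xu=0$ in the sense of distributions; and $(\mathbf v_1+v)\otimes(\mathbf v_1+v)-(u_1+u)=\tfrac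 C2\mathrm{Id}$ a.e. in $\Lambda$. In particular its density is $\rho_1$ and the squared modulus of its velocity is $C$ a.e. in $P_1$. The maps are taken periodic in $x_1$ with a fixed period $2L_3>0$. **Hybrid solutions.** Given an admissible fan sub-solution and $T_0>0$, a hybrid solution is constructed on $(0,T_0)$ in the same way but with $\Lambda=P_1\cap\{0<t<T_0\}$ (so for times $t<T_0$ it coincides with a convex integration solution), and on $[T_0,T_1)$, for some $T_1>T_0$, it is the one-dimensional entropic solution built from elementary waves (shocks, rarefactions) with the piecewise constant data $(\bar\rho,\bar v)(T_0,\cdot)$ at time $T_0$. **Action.** $\Omega=[-L_3,L_3]\times[\ell_1,\ell_2]$ with $\ell_1<0<\ell_2$, and only times $t>0$ so small that $\ell_1<\nu_-t$ and $\nu_+t<\ell_2$ for all the wave speeds $\nu_\pm$ of the solutions compared are considered (outside the region between the waves all solutions in $S$ coincide). With $\mathcal L=\tfrac12\rho|v|^2-\rho e(\rho)$, the action is $A(\rho,v)(0,t)=\int_0^t\int_\Omega\mathcal L\,dx\,d\tau$. **Admissibility criteria** (with initial time $t_0=0$; $w,z$ denote solutions in $S$). - $w$ is strictly preferred to $z\ne w$ under LAAP$_0$ if there is $t_1=t_1(z)>0$ with $A(w)(0,t)\le A(z)(0,t)$ for all $t\in(0,t_1)$ and $A(w)(0,t)<A(z)(0,t)$ for some $t\in(0,t_1)$. $w$ is strictly LAAP$_0$-admissible in $S$ if it is strictly preferred to every $z\in S$, $z\ne w$. - $w$ is sARAC-admissible in $S$ if for every $z\in S$, $z\neq w$, there is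 $k\in\mathbb N$ such that the right derivatives at $t=0$ satisfy $\frac{d^r}{dt^r}A(w)(0,t)|_{t=0^+}=\frac{d^r}{dt^r}A(z)(0,t)|_{t=0^+}$ for $r=0,\dots,k-1$ and $\frac{d^k}{dt^k}A(w)(0,t)|_{t=0^+}<\frac{d^k}{dt^k}A(z)(0,t)|_{t=0^+}$. *)

theory Defs
  imports "HOL-Analysis.Analysis"
begin

section \<open>Conservation laws in the sense of distributions\<close>

text \<open>Points of space-time are pairs (t, x); the coordinates of x are indexed by 1, 2 :: 2.\<close>

type_synonym spacetime = "real \<times> (real^2)"

primrec Ck :: "nat \<Rightarrow> ('a::euclidean_space \<Rightarrow> real) \<Rightarrow> bool" where
  "Ck 0 f \<longleftrightarrow> continuous_on UNIV f"
| "Ck (Suc k) f \<longleftrightarrow> (\<forall>x. f differentiable (at x)) \<and>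
     (\<forall>b\<in>Basis. Ck k (\<lambda>x. frechet_derivative f (at x) b))"

definition before :: "ereal \<Rightarrow> spacetime set" where
  "before T = {p. ereal (fst p) < T}"

definition strip :: "real \<Rightarrow> ereal \<Rightarrow> spacetime set" where
  "strip t\<^sub>0 T = {p. t\<^sub>0 < fst p} \<inter> before T"

text \<open>A test function need not vanish at the initial time, so that the weak formulation below
  contains the initial data.\<close>

definition test_functions :: "ereal \<Rightarrow> (spacetime \<Rightarrow> real) set" where
  "test_functions T = {\<phi>. (\<forall>k. Ck k \<phi>) \<and> compact (closure {p. \<phi> p \<noteq> 0}) \<and>
     closure {p. \<phi> p \<noteq> 0} \<subseteq> before T}"

definition dt :: "(spacetime \<Rightarrow> real) \<Rightarrow> spacetime \<Rightarrow> real" where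
  "dt \<phi> p = frechet_derivative \<phi> (at p) (1, 0)"

definition grad :: "(spacetime \<Rightarrow> real) \<Rightarrow> spacetime \<Rightarrow> real^2" where
  "grad \<phi> p = (\<chi> i. frechet_derivative \<phi> (at p) (0, axis i 1))"

definition weak_form ::
  "real \<Rightarrow> ereal \<Rightarrow> (spacetime \<Rightarrow> real) \<Rightarrow> (spacetime \<Rightarrow> real^2) \<Rightarrow> (real^2 \<Rightarrow> real) \<Rightarrow>
     (spacetime \<Rightarrow> real) \<Rightarrow> real" where
  "weak_form t\<^sub>0 T U F U\<^sub>0 \<phi> =
     (LINT p:strip t\<^sub>0 T|lebesgue. U p * dt \<phi> p + F p \<bullet> grad \<phi> p)
     + (LINT x|lebesgue. U\<^sub>0 x * \<phi> (t\<^sub>0, x))"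

definition weak_data ::
  "real \<Rightarrow> ereal \<Rightarrow> (spacetime \<Rightarrow> real) \<Rightarrow> (spacetime \<Rightarrow> real^2) \<Rightarrow> (real^2 \<Rightarrow> real) \<Rightarrow> bool" where
  "weak_data t\<^sub>0 T U F U\<^sub>0 \<longleftrightarrow>
     (\<forall>K. compact K \<and> K \<subseteq> before T \<longrightarrow>
        set_integrable lebesgue (K \<inter> strip t\<^sub>0 T) U \<and>
        set_integrable lebesgue (K \<inter> strip t\<^sub>0 T) F) \<and>
     (\<forall>K. compact K \<longrightarrow> set_integrable lebesgue K U\<^sub>0)"

text \<open>The equation (resp. inequality with sign \<open>\<le> 0\<close>) for the time derivative of U plus the
  divergence of F, on times between \<open>t\<^sub>0\<close> and T, with U equal to \<open>U\<^sub>0\<close> at time \<open>t\<^sub>0\<close>.\<close>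

definition conservation_law ::
  "real \<Rightarrow> ereal \<Rightarrow> (spacetime \<Rightarrow> real) \<Rightarrow> (spacetime \<Rightarrow> real^2) \<Rightarrow> (real^2 \<Rightarrow> real) \<Rightarrow> bool" where
  "conservation_law t\<^sub>0 T U F U\<^sub>0 \<longleftrightarrow> weak_data t\<^sub>0 T U F U\<^sub>0 \<and>
     (\<forall>\<phi>\<in>test_functions T. weak_form t\<^sub>0 T U F U\<^sub>0 \<phi> = 0)"

definition dissipation_law ::
  "real \<Rightarrow> ereal \<Rightarrow> (spacetime \<Rightarrow> real) \<Rightarrow> (spacetime \<Rightarrow> real^2) \<Rightarrow> (real^2 \<Rightarrow> real) \<Rightarrow> bool" where
  "dissipation_law t\<^sub>0 T U F U\<^sub>0 \<longleftrightarrow> weak_data t\<^sub>0 T U F U\<^sub>0 \<and>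
     (\<forall>\<phi>\<in>test_functions T. (\<forall>p. 0 \<le> \<phi> p) \<longrightarrow> 0 \<le> weak_form t\<^sub>0 T U F U\<^sub>0 \<phi>)"


section \<open>The isentropic Euler system\<close>

definition pressure :: "real \<Rightarrow> real" where
  "pressure r = r\<^sup>2"

text \<open>Specific internal energy, with derivative \<open>pressure r / r\<^sup>2\<close>.\<close>

definition int_energy :: "real \<Rightarrow> real" where
  "int_energy r = r"

definition energy :: "real \<Rightarrow> real^2 \<Rightarrow> real" where
  "energy r v = r * int_energy r + 1/2 * r * (norm v)\<^sup>2"

definition entropic_solution ::
  "real \<Rightarrow> ereal \<Rightarrow> (real^2 \<Rightarrow> real) \<Rightarrow> (real^2 \<Rightarrow> real^2) \<Rightarrow>
     (spacetime \<Rightarrow> real) \<Rightarrow> (spacetime \<Rightarrow> real^2) \<Rightarrow> bool" where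
  "entropic_solution t\<^sub>0 T r\<^sub>0 v\<^sub>0 r v \<longleftrightarrow>
     (\<forall>p\<in>strip t\<^sub>0 T. 0 < r p) \<and>
     conservation_law t\<^sub>0 T r (\<lambda>p. r p *\<^sub>R v p) r\<^sub>0 \<and>
     (\<forall>i. conservation_law t\<^sub>0 T (\<lambda>p. r p * v p $ i)
        (\<lambda>p. (r p * v p $ i) *\<^sub>R v p + pressure (r p) *\<^sub>R axis i 1)
        (\<lambda>x. r\<^sub>0 x * v\<^sub>0 x $ i)) \<and>
     dissipation_law t\<^sub>0 T (\<lambda>p. energy (r p) (v p))
        (\<lambda>p. (energy (r p) (v p) + pressure (r p)) *\<^sub>R v p)
        (\<lambda>x. energy (r\<^sub>0 x) (v\<^sub>0 x))"

record riemann_data =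
  rho_minus :: real
  rho_plus :: real
  v_minus :: real
  v_plus :: real

definition vert :: "real \<Rightarrow> real^2" where
  "vert a = vector [0, a]"

definition init_rho :: "riemann_data \<Rightarrow> real^2 \<Rightarrow> real" where
  "init_rho D x = (if x $ 2 < 0 then rho_minus D else rho_plus D)"

definition init_vel :: "riemann_data \<Rightarrow> real^2 \<Rightarrow> real^2" where
  "init_vel D x = vert (if x $ 2 < 0 then v_minus D else v_plus D)"

definition P_minus :: "real \<Rightarrow> spacetime set" where
  "P_minus \<nu>\<^sub>m = {(t, x). 0 < t \<and> x $ 2 < \<nu>\<^sub>m * t}"

definition P_mid :: "real \<Rightarrow> real \<Rightarrow> spacetime set" where
  "P_mid \<nu>\<^sub>m \<nu>\<^sub>p = {(t, x). 0 < t \<and> \<nu>\<^sub>m * t < x $ 2 \<and> x $ 2 < \<nu>\<^sub>p * t}"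

definition P_plus :: "real \<Rightarrow> spacetime set" where
  "P_plus \<nu>\<^sub>p = {(t, x). 0 < t \<and> \<nu>\<^sub>p * t < x $ 2}"

text \<open>The field with values a, b, c on the three regions; the values on the two (null) interfaces
  and for negative times play no role.\<close>

definition fan :: "real \<Rightarrow> real \<Rightarrow> 'a \<Rightarrow> 'a \<Rightarrow> 'a \<Rightarrow> spacetime \<Rightarrow> 'a" where
  "fan \<nu>\<^sub>m \<nu>\<^sub>p a b c = (\<lambda>(t, x). if x $ 2 < \<nu>\<^sub>m * t then a else if x $ 2 < \<nu>\<^sub>p * t then b else c)"


section \<open>The solutions that are compared\<close>

text \<open>A solution lives on the times \<open>0 < t < lifespan\<close>; its values at later times are irrelevant.\<close>

record solution =
  lifespan :: ereal
  dens :: "spacetime \<Rightarrow> real"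
  vel :: "spacetime \<Rightarrow> real^2"

definition same_solution :: "solution \<Rightarrow> solution \<Rightarrow> bool" where
  "same_solution w z \<longleftrightarrow> lifespan w = lifespan z \<and>
     (AE p in lebesgue. p \<in> strip 0 (lifespan w) \<longrightarrow> dens w p = dens z p \<and> vel w p = vel z p)"

definition two_shock :: "riemann_data \<Rightarrow> real \<Rightarrow> real \<Rightarrow> real \<Rightarrow> real \<Rightarrow> solution" where
  "two_shock D \<rho>\<^sub>m v\<^sub>m \<nu>\<^sub>m \<nu>\<^sub>p =
     \<lparr>lifespan = \<infinity>,
      dens = fan \<nu>\<^sub>m \<nu>\<^sub>p (rho_minus D) \<rho>\<^sub>m (rho_plus D),
      vel = fan \<nu>\<^sub>m \<nu>\<^sub>p (vert (v_minus D)) (vert v\<^sub>m) (vert (v_plus D))\<rparr>"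

definition is_two_shock :: "riemann_data \<Rightarrow> real \<Rightarrow> real \<Rightarrow> real \<Rightarrow> real \<Rightarrow> bool" where
  "is_two_shock D \<rho>\<^sub>m v\<^sub>m \<nu>\<^sub>m \<nu>\<^sub>p \<longleftrightarrow>
     \<nu>\<^sub>m < \<nu>\<^sub>p \<and> max (rho_minus D) (rho_plus D) < \<rho>\<^sub>m \<and>
     entropic_solution 0 \<infinity> (init_rho D) (init_vel D)
       (dens (two_shock D \<rho>\<^sub>m v\<^sub>m \<nu>\<^sub>m \<nu>\<^sub>p)) (vel (two_shock D \<rho>\<^sub>m v\<^sub>m \<nu>\<^sub>m \<nu>\<^sub>p))"


subsection \<open>Fan sub-solutions\<close>

definition outer :: "real^2 \<Rightarrow> real^2 \<Rightarrow> real^2^2" where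
  "outer a b = (\<chi> i j. a $ i * b $ j)"

definition sym_tracefree :: "(real^2^2) set" where
  "sym_tracefree = {u. transpose u = u \<and> trace u = 0}"

definition pos_definite :: "real^2^2 \<Rightarrow> bool" where
  "pos_definite M \<longleftrightarrow> transpose M = M \<and> (\<forall>y. y \<noteq> 0 \<longrightarrow> 0 < y \<bullet> (M *v y))"

text \<open>The free parameters of a fan sub-solution; the states in the two outer regions are given by
  the Riemann data.\<close>

record fan_state =
  nu_minus :: real
  nu_plus :: real
  rho1 :: real
  v1 :: "real^2"
  u1 :: "real^2^2"
  CC :: real

definition mid :: "fan_state \<Rightarrow> spacetime set" where
  "mid F = P_mid (nu_minus F) (nu_plus F)"

definition sides :: "fan_state \<Rightarrow> spacetime set" where
  "sides F = P_minus (nu_minus F) \<union> P_plus (nu_plus F)"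

definition fan_rho :: "riemann_data \<Rightarrow> fan_state \<Rightarrow> spacetime \<Rightarrow> real" where
  "fan_rho D F = fan (nu_minus F) (nu_plus F) (rho_minus D) (rho1 F) (rho_plus D)"

definition fan_v :: "riemann_data \<Rightarrow> fan_state \<Rightarrow> spacetime \<Rightarrow> real^2" where
  "fan_v D F = fan (nu_minus F) (nu_plus F) (vert (v_minus D)) (v1 F) (vert (v_plus D))"

definition outer_state :: "real^2 \<Rightarrow> real^2^2" where
  "outer_state a = outer a a - mat (1/2 * (norm a)\<^sup>2)"

definition fan_u :: "riemann_data \<Rightarrow> fan_state \<Rightarrow> spacetime \<Rightarrow> real^2^2" where
  "fan_u D F = fan (nu_minus F) (nu_plus F)
     (outer_state (vert (v_minus D))) (u1 F) (outer_state (vert (v_plus D)))"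

definition fan_kin :: "riemann_data \<Rightarrow> fan_state \<Rightarrow> spacetime \<Rightarrow> real" where
  "fan_kin D F p = 1/2 * (CC F * rho1 F * indicator (mid F) p
     + fan_rho D F p * (norm (fan_v D F p))\<^sup>2 * indicator (sides F) p)"

definition fan_subsolution :: "riemann_data \<Rightarrow> fan_state \<Rightarrow> bool" where
  "fan_subsolution D F \<longleftrightarrow>
     nu_minus F < nu_plus F \<and> 0 < rho1 F \<and> u1 F \<in> sym_tracefree \<and>
     0 < CC F \<and> pos_definite (mat (CC F / 2) - (outer (v1 F) (v1 F) - u1 F)) \<and>
     conservation_law 0 \<infinity> (fan_rho D F) (\<lambda>p. fan_rho D F p *\<^sub>R fan_v D F p) (init_rho D) \<and>
     (\<forall>i. conservation_law 0 \<infinity> (\<lambda>p. fan_rho D F p * fan_v D F p $ i)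
        (\<lambda>p. fan_rho D F p *\<^sub>R (fan_u D F p $ i)
             + (pressure (fan_rho D F p) + fan_kin D F p) *\<^sub>R axis i 1)
        (\<lambda>x. init_rho D x * init_vel D x $ i))"

definition admissible_fan :: "riemann_data \<Rightarrow> fan_state \<Rightarrow> bool" where
  "admissible_fan D F \<longleftrightarrow> fan_subsolution D F \<and>
     dissipation_law 0 \<infinity>
       (\<lambda>p. fan_rho D F p * int_energy (fan_rho D F p) + fan_kin D F p)
       (\<lambda>p. (fan_rho D F p * int_energy (fan_rho D F p) + pressure (fan_rho D F p)
             + fan_kin D F p) *\<^sub>R fan_v D F p)
       (\<lambda>x. energy (init_rho D x) (init_vel D x))"

text \<open>The parameter \<open>C/2 + g\<close>, where \<open>u1 = diag (g, -g)\<close>.\<close>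

definition eps2 :: "fan_state \<Rightarrow> real" where
  "eps2 F = CC F / 2 + u1 F $ 1 $ 1"

text \<open>\<open>\<rho>\<^sub>s\<close> is the left end point of an interval \<open>[\<rho>\<^sub>s, \<rho>\<^sub>m]\<close> of densities on which admissibility leaves
  room for a positive \<open>eps2\<close>. At \<open>\<rho>\<^sub>m\<close> itself the other parameter \<open>C/2 - g - \<beta>\<^sup>2\<close> vanishes, so the
  strict matrix inequality excludes a fan sub-solution and nothing is to be required there.\<close>

definition fan_interval :: "riemann_data \<Rightarrow> real \<Rightarrow> real \<Rightarrow> bool" where
  "fan_interval D \<rho>\<^sub>s \<rho>\<^sub>m \<longleftrightarrow>
     max (rho_minus D) (rho_plus D) < \<rho>\<^sub>s \<and> \<rho>\<^sub>s < \<rho>\<^sub>m \<and>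
     (\<forall>r\<in>{\<rho>\<^sub>s..<\<rho>\<^sub>m}. \<exists>F. admissible_fan D F \<and> rho1 F = r \<and> 0 < eps2 F)"


subsection \<open>Convex integration solutions\<close>

text \<open>Bounded perturbations supported in \<open>\<Lambda>\<close>; the linear equations hold on all of space-time, hence
  also across the boundary of \<open>\<Lambda>\<close>.\<close>

definition perturbation ::
  "real \<Rightarrow> fan_state \<Rightarrow> spacetime set \<Rightarrow> (spacetime \<Rightarrow> real^2) \<Rightarrow> (spacetime \<Rightarrow> real^2^2) \<Rightarrow> bool" where
  "perturbation L\<^sub>3 F \<Lambda> v u \<longleftrightarrow>
     v \<in> borel_measurable lebesgue \<and> u \<in> borel_measurable lebesgue \<and>
     bounded (range v) \<and> bounded (range u) \<and> range u \<subseteq> sym_tracefree \<and>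
     (\<forall>p. p \<notin> \<Lambda> \<longrightarrow> v p = 0 \<and> u p = 0) \<and>
     (\<forall>\<phi>\<in>test_functions \<infinity>. (LINT p|lebesgue. v p \<bullet> grad \<phi> p) = 0) \<and>
     (\<forall>\<phi>\<in>test_functions \<infinity>. \<forall>i. (LINT p|lebesgue. v p $ i * dt \<phi> p + u p $ i \<bullet> grad \<phi> p) = 0) \<and>
     (AE p in lebesgue. p \<in> \<Lambda> \<longrightarrow>
        outer (v1 F + v p) (v1 F + v p) - (u1 F + u p) = mat (CC F / 2)) \<and>
     (\<forall>t x. v (t, x + axis 1 (2 * L\<^sub>3)) = v (t, x) \<and> u (t, x + axis 1 (2 * L\<^sub>3)) = u (t, x))"

definition convex_integration_solution ::
  "real \<Rightarrow> riemann_data \<Rightarrow> fan_state \<Rightarrow> solution \<Rightarrow> bool" where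
  "convex_integration_solution L\<^sub>3 D F z \<longleftrightarrow>
     (\<exists>v u. perturbation L\<^sub>3 F (mid F) v u \<and>
        z = \<lparr>lifespan = \<infinity>, dens = fan_rho D F, vel = (\<lambda>p. fan_v D F p + v p)\<rparr>)"


subsection \<open>Hybrid solutions\<close>

definition sound_speed :: "real \<Rightarrow> real" where
  "sound_speed r = sqrt (deriv pressure r)"

text \<open>A centred rarefaction wave of the family with characteristic speed \<open>V + s * sound_speed R\<close>,
  as a function of the self-similar variable.\<close>

definition rarefaction_on :: "real set \<Rightarrow> (real \<Rightarrow> real) \<Rightarrow> (real \<Rightarrow> real) \<Rightarrow> bool" where
  "rarefaction_on J R V \<longleftrightarrow> (\<exists>s\<in>{-1, 1}. \<forall>\<xi>\<in>J.
     V \<xi> + s * sound_speed (R \<xi>) = \<xi> \<and>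
     (\<exists>R' V'. (R has_real_derivative R') (at \<xi>) \<and> (V has_real_derivative V') (at \<xi>) \<and>
        R \<xi> * V' = s * sound_speed (R \<xi>) * R'))"

text \<open>Self-similar profile made of constant states, centred rarefactions and jumps (at the
  points of \<open>\<xi>s\<close>), connecting \<open>(rl, vl)\<close> to \<open>(rr, vr)\<close>. That the jumps are entropic shocks is part of
  the entropic weak formulation required in \<open>hybrid_solution\<close>.\<close>

definition elementary_waves ::
  "real list \<Rightarrow> (real \<Rightarrow> real) \<Rightarrow> (real \<Rightarrow> real) \<Rightarrow> real \<Rightarrow> real \<Rightarrow> real \<Rightarrow> real \<Rightarrow> bool" where
  "elementary_waves \<xi>s R V rl vl rr vr \<longleftrightarrow>
     \<xi>s \<noteq> [] \<and> sorted_wrt (<) \<xi>s \<and>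
     (\<forall>\<xi><hd \<xi>s. R \<xi> = rl \<and> V \<xi> = vl) \<and> (\<forall>\<xi>>last \<xi>s. R \<xi> = rr \<and> V \<xi> = vr) \<and>
     (\<forall>i. Suc i < length \<xi>s \<longrightarrow>
        R constant_on {\<xi>s ! i<..<\<xi>s ! Suc i} \<and> V constant_on {\<xi>s ! i<..<\<xi>s ! Suc i} \<or>
        rarefaction_on {\<xi>s ! i<..<\<xi>s ! Suc i} R V)"

text \<open>From \<open>T\<^sub>0\<close> on, a Riemann problem is solved at each of the two jumps \<open>\<nu>\<^sub>\<plusminus> T\<^sub>0\<close> of the fan
  sub-solution; the waves of the two Riemann problems do not meet before \<open>T\<^sub>1\<close>.\<close>

definition hybrid_solution ::
  "real \<Rightarrow> riemann_data \<Rightarrow> fan_state \<Rightarrow> solution \<Rightarrow> bool" where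
  "hybrid_solution L\<^sub>3 D F z \<longleftrightarrow>
     (\<exists>T\<^sub>0 T\<^sub>1 v u. 0 < T\<^sub>0 \<and> T\<^sub>0 < T\<^sub>1 \<and> lifespan z = ereal T\<^sub>1 \<and>
        perturbation L\<^sub>3 F (mid F \<inter> {p. fst p < T\<^sub>0}) v u \<and>
        (\<forall>p. 0 < fst p \<and> fst p < T\<^sub>0 \<longrightarrow> dens z p = fan_rho D F p \<and> vel z p = fan_v D F p + v p) \<and>
        (\<forall>x. dens z (T\<^sub>0, x) = fan_rho D F (T\<^sub>0, x) \<and> vel z (T\<^sub>0, x) = fan_v D F (T\<^sub>0, x)) \<and>
        entropic_solution T\<^sub>0 (ereal T\<^sub>1) (\<lambda>x. fan_rho D F (T\<^sub>0, x)) (\<lambda>x. fan_v D F (T\<^sub>0, x))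
          (dens z) (vel z) \<and>
        (\<exists>\<xi>l Rl Vl \<xi>r Rr Vr.
           elementary_waves \<xi>l Rl Vl (rho_minus D) (v_minus D) (rho1 F) (v1 F $ 2) \<and>
           elementary_waves \<xi>r Rr Vr (rho1 F) (v1 F $ 2) (rho_plus D) (v_plus D) \<and>
           (\<forall>t\<in>{T\<^sub>0<..<T\<^sub>1}.
              nu_minus F * T\<^sub>0 + last \<xi>l * (t - T\<^sub>0) \<le> nu_plus F * T\<^sub>0 + hd \<xi>r * (t - T\<^sub>0) \<and>
              (\<forall>x. if x $ 2 < nu_plus F * T\<^sub>0 + hd \<xi>r * (t - T\<^sub>0)
                   then dens z (t, x) = Rl ((x $ 2 - nu_minus F * T\<^sub>0) / (t - T\<^sub>0)) \<and>
                        vel z (t, x) = vert (Vl ((x $ 2 - nu_minus F * T\<^sub>0) / (t - T\<^sub>0)))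
                   else dens z (t, x) = Rr ((x $ 2 - nu_plus F * T\<^sub>0) / (t - T\<^sub>0)) \<and>
                        vel z (t, x) = vert (Vr ((x $ 2 - nu_plus F * T\<^sub>0) / (t - T\<^sub>0)))))))"

definition solution_set ::
  "real \<Rightarrow> riemann_data \<Rightarrow> real set \<Rightarrow> solution \<Rightarrow> solution set" where
  "solution_set L\<^sub>3 D I w = {w} \<union>
     {z. \<exists>F. admissible_fan D F \<and> rho1 F \<in> I \<and> 0 < eps2 F \<and>
        (convex_integration_solution L\<^sub>3 D F z \<or> hybrid_solution L\<^sub>3 D F z)}"


section \<open>Action and admissibility criteria\<close>

definition Omega :: "real \<Rightarrow> real \<Rightarrow> real \<Rightarrow> (real^2) set" where
  "Omega L\<^sub>3 l\<^sub>1 l\<^sub>2 = {x. - L\<^sub>3 \<le> x $ 1 \<and> x $ 1 \<le> L\<^sub>3 \<and> l\<^sub>1 \<le> x $ 2 \<and> x $ 2 \<le> l\<^sub>2}"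

definition lagrangian :: "real \<Rightarrow> real^2 \<Rightarrow> real" where
  "lagrangian r v = 1/2 * r * (norm v)\<^sup>2 - r * int_energy r"

definition action :: "(real^2) set \<Rightarrow> solution \<Rightarrow> real \<Rightarrow> real" where
  "action \<Omega> z t = (LINT p:{0..t} \<times> \<Omega>|lebesgue. lagrangian (dens z p) (vel z p))"

text \<open>Times up to \<open>t\<^sub>1\<close> are small for z: the solution exists, and its waves have not left the
  interval \<open>(l\<^sub>1, l\<^sub>2)\<close>, i.e. it still coincides with the initial data outside. For a fan with
  speeds \<open>\<nu>\<^sub>\<plusminus>\<close> this means \<open>l\<^sub>1 < \<nu>\<^sub>- t\<close> and \<open>\<nu>\<^sub>+ t < l\<^sub>2\<close> for \<open>0 < t < t\<^sub>1\<close>.\<close>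

definition small_time :: "riemann_data \<Rightarrow> real \<Rightarrow> real \<Rightarrow> solution \<Rightarrow> real \<Rightarrow> bool" where
  "small_time D l\<^sub>1 l\<^sub>2 z t\<^sub>1 \<longleftrightarrow> ereal t\<^sub>1 \<le> lifespan z \<and>
     (AE p in lebesgue. 0 < fst p \<and> fst p < t\<^sub>1 \<and> snd p $ 2 \<notin> {l\<^sub>1<..<l\<^sub>2} \<longrightarrow>
        dens z p = init_rho D (snd p) \<and> vel z p = init_vel D (snd p))"

definition strictly_preferred_LAAP0 ::
  "riemann_data \<Rightarrow> real \<Rightarrow> real \<Rightarrow> real \<Rightarrow> solution \<Rightarrow> solution \<Rightarrow> bool" where
  "strictly_preferred_LAAP0 D L\<^sub>3 l\<^sub>1 l\<^sub>2 w z \<longleftrightarrow>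
     (\<exists>t\<^sub>1>0. small_time D l\<^sub>1 l\<^sub>2 w t\<^sub>1 \<and> small_time D l\<^sub>1 l\<^sub>2 z t\<^sub>1 \<and>
        (\<forall>t\<in>{0<..<t\<^sub>1}. action (Omega L\<^sub>3 l\<^sub>1 l\<^sub>2) w t \<le> action (Omega L\<^sub>3 l\<^sub>1 l\<^sub>2) z t) \<and>
        (\<exists>t\<in>{0<..<t\<^sub>1}. action (Omega L\<^sub>3 l\<^sub>1 l\<^sub>2) w t < action (Omega L\<^sub>3 l\<^sub>1 l\<^sub>2) z t))"

definition strictly_LAAP0_admissible ::
  "riemann_data \<Rightarrow> real \<Rightarrow> real \<Rightarrow> real \<Rightarrow> solution set \<Rightarrow> solution \<Rightarrow> bool" where
  "strictly_LAAP0_admissible D L\<^sub>3 l\<^sub>1 l\<^sub>2 S w \<longleftrightarrow>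
     w \<in> S \<and> (\<forall>z\<in>S. \<not> same_solution w z \<longrightarrow> strictly_preferred_LAAP0 D L\<^sub>3 l\<^sub>1 l\<^sub>2 w z)"

text \<open>d is the r-th iterated right derivative of f at 0: the derivatives of order less than r are
  needed on some \<open>[0, \<delta>)\<close>, that of order r only at 0.\<close>

definition has_right_derivative0 :: "nat \<Rightarrow> (real \<Rightarrow> real) \<Rightarrow> real \<Rightarrow> bool" where
  "has_right_derivative0 r f d \<longleftrightarrow>
     (\<exists>g \<delta>. 0 < \<delta> \<and> g 0 = f \<and> g r 0 = d \<and>
        (\<forall>i<r. (g i has_real_derivative g (Suc i) 0) (at_right 0)) \<and>
        (\<forall>i. Suc i < r \<longrightarrow> (\<forall>t\<in>{0<..<\<delta>}. (g i has_real_derivative g (Suc i) t) (at_right t))))"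

definition sARAC_admissible :: "(real^2) set \<Rightarrow> solution set \<Rightarrow> solution \<Rightarrow> bool" where
  "sARAC_admissible \<Omega> S w \<longleftrightarrow>
     w \<in> S \<and> (\<forall>z\<in>S. \<not> same_solution w z \<longrightarrow>
       (\<exists>k. (\<forall>r<k. \<exists>d. has_right_derivative0 r (action \<Omega> w) d \<and>
                        has_right_derivative0 r (action \<Omega> z) d) \<and>
            (\<exists>dw dz. has_right_derivative0 k (action \<Omega> w) dw \<and>
                     has_right_derivative0 k (action \<Omega> z) dz \<and> dw < dz)))"

end

theory Submission
  imports Defs
begin

text \<open>
  Up to a small time every solution in the set has the same shape: two fronts emanate from the
  origin with speeds \<open>x < y\<close>, outside of them the data persist, and between them the Lagrangian
  is almost everywhere a constant. For a convex integration solution, and for a hybrid solution before its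
  switching time, this holds in spite of the oscillations, because the trace of the pointwise
  constraint fixes the squared speed to be \<open>C\<close> (\<open>fan_shaped_perturbation\<close>). Hence the action is
  \<open>b * t + c * t\<^sup>2 / 2\<close> near zero, where \<open>b\<close> depends on the data only and \<open>c\<close> is a positive multiple of
  \<open>x * L\<^sub>- - y * L\<^sub>+ + (y - x) * L\<^sub>1\<close>, the \<open>L\<close> being the three values of the Lagrangian (\<open>fan_shaped_action\<close>).
  Both criteria reduce to the claim that \<open>c\<close> is strictly smaller for the two shocks.

  The Rankine--Hugoniot conditions, which are extracted from the weak formulation with test functions
  travelling along one front (\<open>jump_condition\<close>), involve \<open>C - \<epsilon>\<^sub>2\<close> but not \<open>\<epsilon>\<^sub>2\<close> separately. So \<open>c\<close>
  is a function of the middle density \<open>r\<close> alone plus a positive multiple of \<open>\<epsilon>\<^sub>2\<close>. That function decreases in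
  \<open>r\<close>: with \<open>a = r - \<rho>\<^sub>-\<close> and \<open>b = r - \<rho>\<^sub>+\<close> the conditions say that the signed measure with mass \<open>b\<close> at
  \<open>y\<close> and \<open>- a\<close> at \<open>x\<close> has first and second moments independent of \<open>r\<close>, its total mass
  \<open>\<rho>\<^sub>- - \<rho>\<^sub>+\<close> being constant as well; and for \<open>p(\<rho>) = \<rho>\<^sup>2\<close> the coefficient is, up to a constant, half of its third moment minus
  \<open>3 / 2 * a * b * (y - x)\<close> (\<open>fan_excess_eq_moments\<close>). When \<open>r\<close> grows, the third moment decreases and
  \<open>a * b * (y - x)\<close> increases (\<open>third_moment_antimono\<close>). The density of the two-shock solution is the right
  end point of the interval of admitted densities, and \<open>\<epsilon>\<^sub>2 > 0\<close> makes the inequality strict.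
\<close>



section \<open>A smooth bump function\<close>

text \<open>The functions \<open>P (1 / s) * exp (- 1 / s)\<close>, extended by zero to \<open>s \<le> 0\<close>. Polynomials \<open>P\<close> are carried
  along, instead of the single function \<open>exp (- 1 / s)\<close>, because then differentiation stays inside
  the family and smoothness becomes a closure property.\<close>

definition flat :: "real poly \<Rightarrow> real \<Rightarrow> real" where
  "flat P s = (if 0 < s then poly P (1 / s) * exp (- (1 / s)) else 0)"

lemma poly_times_exp_minus_tendsto_0:
  fixes P :: "real poly"
  shows "((\<lambda>u. poly P u * exp (- u)) \<longlongrightarrow> 0) at_top"
proof -
  have "((\<lambda>u. \<Sum>i\<le>degree P. coeff P i * (u ^ i / exp u)) \<longlongrightarrow> 0) at_top"
    by (intro tendsto_null_sum tendsto_mult_right_zero tendsto_power_div_exp_0)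
  moreover have "(\<lambda>u. \<Sum>i\<le>degree P. coeff P i * (u ^ i / exp u)) = (\<lambda>u. poly P u * exp (- u))"
    by (simp add: poly_altdef sum_distrib_right exp_minus divide_inverse mult.assoc)
  ultimately show ?thesis by simp
qed

lemma flat_tendsto_0: "(flat P \<longlongrightarrow> 0) (at_right 0)"
proof -
  have "((\<lambda>s. poly P (inverse s) * exp (- inverse s)) \<longlongrightarrow> 0) (at_right (0::real))"
    using filterlim_compose[OF poly_times_exp_minus_tendsto_0[of P] filterlim_inverse_at_top_right] .
  then show ?thesis
    by (rule Lim_transform_eventually)
       (auto simp: eventually_at flat_def inverse_eq_divide intro!: exI[of _ 1])
qed

lemma flat_has_derivative:
  "(flat P has_real_derivative flat ([:0, 0, 1:] * (P - pderiv P)) s) (at s)"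
proof (cases "s = 0")
  case False
  show ?thesis
  proof (cases "0 < s")
    case True
    have "((\<lambda>s. poly P (1 / s) * exp (- (1 / s))) has_real_derivative
        flat ([:0, 0, 1:] * (P - pderiv P)) s) (at s)"
      using True
      by (auto intro!: derivative_eq_intros DERIV_chain2[OF poly_DERIV]
          simp: flat_def power2_eq_square field_simps)
    then show ?thesis
      by (rule has_field_derivative_transform_within_open[of _ _ _ "{0<..}"])
        (use True in \<open>auto simp: flat_def\<close>)
  next
    case F: False
    have "((\<lambda>s. 0) has_real_derivative flat ([:0, 0, 1:] * (P - pderiv P)) s) (at s)"
      using F by (auto simp: flat_def)
    then show ?thesis
      by (rule has_field_derivative_transform_within_open[of _ _ _ "{..<0}"])
        (use F False in \<open>auto simp: flat_def\<close>)
  qed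
next
  case True
  \<comment> \<open>On the right, the difference quotient is again a flat function, namely for \<open>pCons 0 P\<close>.\<close>
  have "((\<lambda>h. flat P h / h) \<longlongrightarrow> 0) (at 0)"
  proof (rule filterlim_split_at)
    have "((\<lambda>h. 0) \<longlongrightarrow> 0) (at_left (0::real))" by simp
    then show "((\<lambda>h. flat P h / h) \<longlongrightarrow> 0) (at_left 0)"
      by (rule Lim_transform_eventually)
         (auto simp: eventually_at flat_def intro!: exI[of _ 1])
    show "((\<lambda>h. flat P h / h) \<longlongrightarrow> 0) (at_right 0)"
      using flat_tendsto_0[of "pCons 0 P"]
      by (rule Lim_transform_eventually)
         (auto simp: eventually_at flat_def intro!: exI[of _ 1])
  qed
  then show ?thesis using True by (auto simp: DERIV_def flat_def)
qed

text \<open>The recursion that defines \<open>Ck\<close> asks for all iterated partial derivatives. A class of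
  differentiable functions that contains the partial derivatives of its members gives them all at
  once, without computing any of them.\<close>

lemma Ck_of_derivative_closed:
  assumes diff: "\<And>f. f \<in> C \<Longrightarrow> \<exists>f'. (\<forall>x. (f has_derivative f' x) (at x)) \<and> (\<forall>b. (\<lambda>x. f' x b) \<in> C)"
    and "f \<in> C"
  shows "Ck k f"
  using \<open>f \<in> C\<close>
proof (induction k arbitrary: f)
  case 0
  then show ?case
    using diff has_derivative_continuous continuous_at_imp_continuous_on by (metis Ck.simps(1))
next
  case (Suc k)
  obtain f' where f': "\<And>x. (f has_derivative f' x) (at x)" "\<And>b. (\<lambda>x. f' x b) \<in> C"
    using diff[OF Suc.prems] by blast
  have "frechet_derivative f (at x) = f' x" for x
    using frechet_derivative_at[OF f'(1)] by simp
  then show ?case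
    using Suc.IH[OF f'(2)] f'(1) by (auto simp: differentiable_def)
qed

inductive_set flat_algebra :: "('a::euclidean_space \<Rightarrow> real) set" where
  flat: "bounded_linear l \<Longrightarrow> (\<lambda>x. flat P (l x + c)) \<in> flat_algebra"
| scale: "f \<in> flat_algebra \<Longrightarrow> (\<lambda>x. r * f x) \<in> flat_algebra"
| add: "f \<in> flat_algebra \<Longrightarrow> g \<in> flat_algebra \<Longrightarrow> (\<lambda>x. f x + g x) \<in> flat_algebra"
| mult: "f \<in> flat_algebra \<Longrightarrow> g \<in> flat_algebra \<Longrightarrow> (\<lambda>x. f x * g x) \<in> flat_algebra"

lemma flat_algebra_derivative:
  assumes "f \<in> flat_algebra"
  shows "\<exists>f'. (\<forall>x. (f has_derivative f' x) (at x)) \<and> (\<forall>b. (\<lambda>x. f' x b) \<in> flat_algebra)"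
  using assms
proof induction
  case (flat l P c)
  let ?P' = "[:0, 0, 1:] * (P - pderiv P)"
  have "((\<lambda>x. flat P (l x + c)) has_derivative (\<lambda>h. l h * flat ?P' (l x + c))) (at x)" for x
    using has_derivative_compose[OF has_derivative_add_const[OF bounded_linear_imp_has_derivative[OF flat], of c]
        flat_has_derivative[of P "l x + c", unfolded has_field_derivative_def]]
    by (simp add: mult.commute)
  moreover have "(\<lambda>x. l b * flat ?P' (l x + c)) \<in> flat_algebra" for b
    by (intro flat_algebra.intros flat)
  ultimately show ?case by (intro exI[of _ "\<lambda>x h. l h * flat ?P' (l x + c)"]) blast
next
  case (scale f r)
  then obtain f' where f': "\<And>x. (f has_derivative f' x) (at x)" "\<And>b. (\<lambda>x. f' x b) \<in> flat_algebra" by blast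
  then show ?case
    by (intro exI[of _ "\<lambda>x h. r * f' x h"]) (auto intro: flat_algebra.intros has_derivative_mult_right)
next
  case (add f g)
  then obtain f' g' where f': "\<And>x. (f has_derivative f' x) (at x)" "\<And>b. (\<lambda>x. f' x b) \<in> flat_algebra"
    and g': "\<And>x. (g has_derivative g' x) (at x)" "\<And>b. (\<lambda>x. g' x b) \<in> flat_algebra" by blast
  then show ?case
    by (intro exI[of _ "\<lambda>x h. f' x h + g' x h"]) (auto intro: flat_algebra.intros has_derivative_add)
next
  case (mult f g)
  then obtain f' g' where f': "\<And>x. (f has_derivative f' x) (at x)" "\<And>b. (\<lambda>x. f' x b) \<in> flat_algebra"
    and g': "\<And>x. (g has_derivative g' x) (at x)" "\<And>b. (\<lambda>x. g' x b) \<in> flat_algebra" by blast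
  have "(\<lambda>x. f x * g' x b + f' x b * g x) \<in> flat_algebra" for b
    by (intro flat_algebra.add flat_algebra.mult f' g' mult.hyps)
  then show ?case
    using has_derivative_mult[OF f'(1) g'(1)]
    by (intro exI[of _ "\<lambda>x h. f x * g' x h + f' x h * g x"]) blast
qed

lemma flat_algebra_Ck: "f \<in> flat_algebra \<Longrightarrow> Ck k f"
  by (rule Ck_of_derivative_closed[of flat_algebra]) (use flat_algebra_derivative in blast)+

definition bump :: "real \<Rightarrow> real" where
  "bump s = flat 1 (s + 1) * flat 1 (1 - s)"

text \<open>Both factors of a bump are flat functions of affine arguments, hence so are products of bumps in
  several affine coordinates; this is how test functions on space-time are obtained.\<close>

lemma bump_affine_flat_algebra: "bounded_linear l \<Longrightarrow> (\<lambda>x. bump (l x + c)) \<in> flat_algebra"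
  using flat_algebra.mult[OF flat_algebra.flat[of l 1 "c + 1"]
      flat_algebra.flat[OF bounded_linear_minus, of l 1 "1 - c"]]
  by (simp add: bump_def algebra_simps)

lemma bump_pos: "\<bar>s\<bar> < 1 \<Longrightarrow> 0 < bump s"
  by (auto simp: bump_def flat_def)

lemma bump_nonneg: "0 \<le> bump s"
  by (auto simp: bump_def flat_def)

lemma bump_eq_0: "1 \<le> \<bar>s\<bar> \<Longrightarrow> bump s = 0"
  by (auto simp: bump_def flat_def)

lemma bump_flat_algebra: "bump \<in> flat_algebra"
  using bump_affine_flat_algebra[OF bounded_linear_ident, of 0] by simp

lemma bump_DERIV: "(bump has_real_derivative deriv bump s) (at s)"
  using flat_algebra_derivative[OF bump_flat_algebra] 
  by (metis DERIV_deriv_iff_real_differentiable differentiable_def)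

lemma continuous_bump: "continuous_on S bump"
  using bump_DERIV by (meson DERIV_isCont continuous_at_imp_continuous_on)

lemma continuous_deriv_bump: "continuous_on S (deriv bump)"
proof -
  obtain f' where f': "\<And>x. (bump has_derivative f' x) (at x)" "\<And>b. (\<lambda>x. f' x b) \<in> flat_algebra"
    using flat_algebra_derivative[OF bump_flat_algebra] by blast
  have "f' x = (*) (deriv bump x)" for x
    using has_derivative_unique[OF f'(1)] bump_DERIV by (auto simp: has_field_derivative_def)
  then have "deriv bump = (\<lambda>x. f' x 1)" by auto
  then show ?thesis
    using flat_algebra_Ck[OF f'(2), of 0] by (metis Ck.simps(1) continuous_on_subset subset_UNIV)
qed

lemma deriv_bump_eq_0: "1 < \<bar>s\<bar> \<Longrightarrow> deriv bump s = 0"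
proof -
  assume s: "1 < \<bar>s\<bar>"
  have "open {s::real. 1 < \<bar>s\<bar>}" by (intro open_Collect_less continuous_intros)
  then have "(bump has_real_derivative 0) (at s)"
    by (rule has_field_derivative_transform_within_open[where f="\<lambda>_. 0", rotated])
      (use s in \<open>auto simp: bump_eq_0\<close>)
  then show ?thesis by (rule DERIV_imp_deriv)
qed

text \<open>A test function that moves with speed \<open>\<nu>\<close>. It lives on times close to \<open>T\<close>; for large \<open>T\<close> the
  two fronts of a fan are further apart than its width, so that it meets only one of them, and it
  does not see the initial data.\<close>

definition travelling_bump :: "real \<Rightarrow> real \<Rightarrow> spacetime \<Rightarrow> real" where
  "travelling_bump \<nu> T p = bump (fst p - T) * bump (snd p $ 1) * bump (snd p $ 2 - \<nu> * fst p)"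

lemma travelling_bump_has_derivative:
  "(travelling_bump \<nu> T has_derivative (\<lambda>(s, h).
      deriv bump (t - T) * s * bump (x $ 1) * bump (x $ 2 - \<nu> * t)
    + bump (t - T) * (deriv bump (x $ 1) * h $ 1) * bump (x $ 2 - \<nu> * t)
    + bump (t - T) * bump (x $ 1) * (deriv bump (x $ 2 - \<nu> * t) * (h $ 2 - \<nu> * s)))) (at (t, x))"
proof -
  have c: "((\<lambda>p. bump (l p)) has_derivative (\<lambda>h. deriv bump (l p) * l' h)) (at p)"
    if "(l has_derivative l') (at p)" for l l' and p :: spacetime
    using has_derivative_compose[OF that bump_DERIV[unfolded has_field_derivative_def]] .
  have 1: "((\<lambda>p. bump (fst p - T)) has_derivative (\<lambda>h. deriv bump (t - T) * fst h)) (at (t, x))"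
    by (rule c[of "\<lambda>p. fst p - T" "\<lambda>h. fst h" "(t, x)", simplified fst_conv snd_conv])
      (auto intro!: derivative_eq_intros)
  have 2: "((\<lambda>p. bump (snd p $ 1)) has_derivative (\<lambda>h. deriv bump (x $ 1) * snd h $ 1)) (at (t, x))"
    by (rule c[of "\<lambda>p. snd p $ 1" "\<lambda>h. snd h $ 1" "(t, x)", simplified fst_conv snd_conv])
      (intro bounded_linear_imp_has_derivative bounded_linear_compose[OF bounded_linear_vec_nth bounded_linear_snd])
  have 3: "((\<lambda>p. bump (snd p $ 2 - \<nu> * fst p)) has_derivative
      (\<lambda>h. deriv bump (x $ 2 - \<nu> * t) * (snd h $ 2 - \<nu> * fst h))) (at (t, x))"
    by (rule c[of "\<lambda>p. snd p $ 2 - \<nu> * fst p" "\<lambda>h. snd h $ 2 - \<nu> * fst h" "(t, x)", simplified fst_conv snd_conv])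
      (intro bounded_linear_imp_has_derivative bounded_linear_sub bounded_linear_const_mult bounded_linear_fst
        bounded_linear_compose[OF bounded_linear_vec_nth bounded_linear_snd])
  show ?thesis
    using has_derivative_mult[OF has_derivative_mult[OF 1 2] 3]
    by (simp add: travelling_bump_def[abs_def] case_prod_unfold algebra_simps)
qed

lemma dt_travelling_bump:
  "dt (travelling_bump \<nu> T) (t, x) =
     (deriv bump (t - T) * bump (x $ 2 - \<nu> * t) - \<nu> * bump (t - T) * deriv bump (x $ 2 - \<nu> * t))
     * bump (x $ 1)"
  unfolding dt_def frechet_derivative_at[OF travelling_bump_has_derivative, symmetric]
  by (simp add: algebra_simps)

lemma grad_travelling_bump:
  "grad (travelling_bump \<nu> T) (t, x) $ 1 = bump (t - T) * deriv bump (x $ 1) * bump (x $ 2 - \<nu> * t)"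
  "grad (travelling_bump \<nu> T) (t, x) $ 2 = bump (t - T) * bump (x $ 1) * deriv bump (x $ 2 - \<nu> * t)"
  unfolding grad_def frechet_derivative_at[OF travelling_bump_has_derivative, symmetric]
  by (simp_all add: axis_def)

lemma travelling_bump_test_function: "travelling_bump \<nu> T \<in> test_functions \<infinity>"
proof -
  have "(\<lambda>p. bump (fst p + - T) * bump ((snd p :: real^2) $ 1 + 0) * bump (snd p $ 2 - \<nu> * fst p + 0)) \<in> flat_algebra"
    by (intro flat_algebra.mult bump_affine_flat_algebra bounded_linear_fst bounded_linear_sub
        bounded_linear_const_mult bounded_linear_compose[OF bounded_linear_vec_nth bounded_linear_snd])
  then have "Ck k (travelling_bump \<nu> T)" for k
    using flat_algebra_Ck by (simp add: travelling_bump_def[abs_def])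
  moreover have "compact (closure {p. travelling_bump \<nu> T p \<noteq> 0})"
  proof -
    define M where "M = \<bar>\<nu>\<bar> * (\<bar>T\<bar> + 1) + 1"
    have "{p. travelling_bump \<nu> T p \<noteq> 0} \<subseteq> cbox (T - 1) (T + 1) \<times> cbox (vector [-1, - M]) (vector [1, M])" (is "?A \<subseteq> ?B")
    proof
      fix p assume "p \<in> ?A"
      obtain t x where p: "p = (t, x)" by (cases p)
      from \<open>p \<in> ?A\<close> have "bump (t - T) \<noteq> 0" "bump (x $ 1) \<noteq> 0" "bump (x $ 2 - \<nu> * t) \<noteq> 0"
        by (auto simp: p travelling_bump_def)
      then have *: "\<bar>t - T\<bar> < 1" "\<bar>x $ 1\<bar> < 1" "\<bar>x $ 2 - \<nu> * t\<bar> < 1"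
        using bump_eq_0 by (meson not_le_imp_less)+
      have "\<bar>\<nu> * t\<bar> \<le> \<bar>\<nu>\<bar> * (\<bar>T\<bar> + 1)"
        unfolding abs_mult using * by (intro mult_left_mono) auto
      then have "- M \<le> x $ 2 \<and> x $ 2 \<le> M"
        using * unfolding M_def by linarith
      then show "p \<in> ?B" using * by (auto simp: p mem_box_cart forall_2)
    qed
    then show ?thesis
      unfolding compact_closure using bounded_subset[OF bounded_Times[OF bounded_cbox bounded_cbox]] by blast
  qed
  moreover have "before \<infinity> = UNIV" by (auto simp: before_def)
  ultimately show ?thesis by (simp add: test_functions_def)
qed


section \<open>Integrals over space-time\<close>

lemma vector2_measurable: "(\<lambda>(a, y). vector [a, y] :: real^2) \<in> borel_measurable (borel :: (real \<times> real) measure)"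
proof -
  have "(\<lambda>(a::real, y::real). vector [a, y] :: real^2) = (\<lambda>p. fst p *\<^sub>R axis 1 1 + snd p *\<^sub>R axis 2 1)"
    by (auto simp: fun_eq_iff vec_eq_iff forall_2 axis_def)
  moreover have "continuous_on UNIV (\<lambda>p::real \<times> real. fst p *\<^sub>R axis 1 1 + snd p *\<^sub>R axis 2 1 :: real^2)"
    by (intro continuous_intros)
  ultimately show ?thesis by (simp add: borel_measurable_continuous_onI)
qed

text \<open>The plane of vectors is the product of two lines also as a measure space, which reduces integrals
  over it to iterated ones.\<close>

lemma lborel_distr_vector2:
  "distr (lborel :: (real \<times> real) measure) borel (\<lambda>(a, y). vector [a, y]) = (lborel :: (real^2) measure)"
proof (rule lborel_eqI[symmetric])
  have m: "(\<lambda>(a, y). vector [a, y] :: real^2) \<in> borel_measurable (lborel :: (real \<times> real) measure)"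
    using vector2_measurable by simp
  fix l u :: "real^2"
  assume lu: "\<And>b. b \<in> Basis \<Longrightarrow> l \<bullet> b \<le> u \<bullet> b"
  have le: "l $ i \<le> u $ i" for i
    using lu[of "axis i 1"] by (simp add: inner_axis)
  have mem_box_pair: "(a, b) \<in> box (p, q) (r, s) \<longleftrightarrow> p < a \<and> a < r \<and> q < b \<and> b < s" for a b p q r s :: real
    by (auto simp: box_def Basis_prod_def ball_Un)
  have vi: "(\<lambda>(a, y). vector [a, y]) -` box l u = box (l $ 1, l $ 2) (u $ 1, u $ 2)"
    by (auto simp: mem_box_cart forall_2 mem_box_pair)
  have inj: "inj (\<lambda>i::2. axis i (1::real))" by (auto simp: inj_on_def axis_eq_axis)
  have B: "(Basis :: (real^2) set) = range (\<lambda>i. axis i 1)"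
    by (auto simp: Basis_vec_def)
  have "(\<Prod>b\<in>Basis. (u - l) \<bullet> b) = (\<Prod>i\<in>UNIV. (u - l) $ i)"
    unfolding B by (simp add: prod.reindex[OF inj] inner_axis)
  also have "\<dots> = (u $ 1 - l $ 1) * (u $ 2 - l $ 2)" by (simp add: UNIV_2)
  finally show "emeasure (distr lborel borel (\<lambda>(a, y). vector [a, y])) (box l u) = ennreal (\<Prod>b\<in>Basis. (u - l) \<bullet> b)"
    using le by (subst emeasure_distr[OF m]) (auto simp: vi emeasure_lborel_box_eq Basis_prod_def prod.union_disjoint)
qed simp

text \<open>The integrability hypothesis of Fubini's theorem, in a form that every slice of a function inherits
  from the function itself.\<close>

lemma integrable_bounded_support:
  fixes f :: "'a::euclidean_space \<Rightarrow> real"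
  assumes "f \<in> borel_measurable borel" and bound: "\<And>x. \<bar>f x\<bar> \<le> B" and supp: "\<And>x. f x \<noteq> 0 \<Longrightarrow> x \<in> cbox l u"
  shows "integrable lborel f"
proof (rule Bochner_Integration.integrable_bound)
  have "emeasure lborel (cbox l u) < \<infinity>"
    by (rule emeasure_lborel_cbox_finite)
  then show "integrable lborel (\<lambda>x. indicator (cbox l u) x *\<^sub>R B)"
    by (intro integrable_indicator integrable_scaleR_left) auto
  show "AE x in lborel. norm (f x) \<le> norm (indicator (cbox l u) x *\<^sub>R B)"
  proof (rule AE_I2)
    show "norm (f x) \<le> norm (indicator (cbox l u) x *\<^sub>R B)" for x
      using bound[of x] supp[of x] by (cases "f x = 0") auto
  qed
qed (use assms in simp)

text \<open>Pointwise bounds on the function and its support make all slices integrable, so that the inner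
  integrals may be split for every value of the outer variables and not only for almost every one.\<close>

lemma integral_spacetime_iterated:
  fixes f :: "spacetime \<Rightarrow> real"
  assumes f[measurable]: "f \<in> borel_measurable borel"
    and bound: "\<And>p. \<bar>f p\<bar> \<le> B"
    and supp: "\<And>t x. f (t, x) \<noteq> 0 \<Longrightarrow> \<bar>t\<bar> \<le> R \<and> \<bar>x $ 1\<bar> \<le> R \<and> \<bar>x $ 2\<bar> \<le> R"
  shows "integral\<^sup>L lebesgue f = (LINT t|lborel. LINT a|lborel. LINT y|lborel. f (t, vector [a, y]))"
proof -
  have slice: "(LINT x|lborel. f (t, x)) = (LINT a|lborel. LINT y|lborel. f (t, vector [a, y]))" for t
  proof -
    have ft[measurable]: "(\<lambda>x. f (t, x)) \<in> borel_measurable borel"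
      by (rule measurable_compose[OF _ f]) (simp add: borel_prod[symmetric])
    have m: "(\<lambda>q. f (t, (\<lambda>(a, y). vector [a, y]) q)) \<in> borel_measurable borel"
      by (rule measurable_compose[OF vector2_measurable ft])
    have "(LINT x|lborel. f (t, x)) = (LINT q|lborel. f (t, (\<lambda>(a, y). vector [a, y]) q))"
      unfolding lborel_distr_vector2[symmetric]
      by (rule integral_distr) (use vector2_measurable in auto)
    also have "integrable lborel (\<lambda>q. f (t, (\<lambda>(a, y). vector [a, y]) q))"
    proof (rule integrable_bounded_support[OF m])
      fix q show "\<bar>f (t, (\<lambda>(a, y). vector [a, y]) q)\<bar> \<le> B" by (rule bound)
      assume "f (t, (\<lambda>(a, y). vector [a, y]) q) \<noteq> 0"
      from supp[OF this] show "q \<in> cbox (-R, -R) (R, R)"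
        by (cases q) (auto simp: abs_le_iff)
    qed
    then have "(LINT q|lborel. f (t, (\<lambda>(a, y). vector [a, y]) q)) = (LINT a|lborel. LINT y|lborel. f (t, vector [a, y]))"
      using lborel_pair.integral_fst'[of "\<lambda>q. f (t, (\<lambda>(a, y). vector [a, y]) q)"] by (simp add: lborel_prod)
    finally show ?thesis .
  qed
  have "integral\<^sup>L lebesgue f = integral\<^sup>L lborel f"
    by (rule integral_completion) simp
  also have "integrable lborel f"
  proof (rule integrable_bounded_support[OF f bound])
    fix p assume "f p \<noteq> 0"
    with supp[of "fst p" "snd p"] show "p \<in> cbox (-R, vector [-R, -R]) (R, vector [R, R])"
      by (cases p) (auto simp: abs_le_iff mem_box_cart forall_2)
  qed
  then have "integral\<^sup>L lborel f = (LINT t|lborel. LINT x|lborel. f (t, x))"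
    using lborel_pair.integral_fst'[of f] by (simp add: lborel_prod)
  finally show ?thesis by (simp add: slice)
qed

lemma spacetime_coordinates_measurable [measurable]:
  "fst \<in> borel_measurable (borel :: spacetime measure)"
  "(\<lambda>p. snd p $ i) \<in> borel_measurable (borel :: spacetime measure)"
  by (intro borel_measurable_continuous_onI continuous_intros)+

lemma fan_measurable [measurable]:
  "fan a b (c::real) d e \<in> borel_measurable borel"
  unfolding fan_def case_prod_unfold by measurable

lemma null_sets_moving_plane: "{p :: spacetime. snd p $ 2 = \<nu> * fst p} \<in> null_sets lebesgue"
proof -
  have "{p :: spacetime. snd p $ 2 = \<nu> * fst p} = {p. (-\<nu>, axis 2 1) \<bullet> p = 0}"
    by (auto simp: inner_prod_def inner_axis inner_axis')
  moreover have "(-\<nu>, axis 2 1 :: real^2) \<noteq> 0"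
    by (simp add: zero_prod_def axis_eq_0_iff)
  ultimately show ?thesis
    using negligible_hyperplane by (metis negligible_iff_null_sets)
qed

lemma AE_not_moving_plane: "AE p in lebesgue. snd (p :: spacetime) $ 2 \<noteq> \<nu> * fst p"
  using null_sets_moving_plane[of \<nu>] by (rule AE_I') auto

lemma integral_cong_AE_lebesgue:
  fixes f :: "'a::euclidean_space \<Rightarrow> real"
  assumes "AE x in lebesgue. f x = g x" and "g \<in> borel_measurable lebesgue"
  shows "integral\<^sup>L lebesgue f = integral\<^sup>L lebesgue g"
  using assms by (intro integral_cong_AE borel_measurable_AE[OF assms(2)]) auto

definition bounded_support :: "(real \<Rightarrow> real) \<Rightarrow> bool" where
  "bounded_support w \<longleftrightarrow> w \<in> borel_measurable borel \<and> (\<exists>B. \<forall>s. \<bar>w s\<bar> \<le> B) \<and> (\<exists>R. \<forall>s. w s \<noteq> 0 \<longrightarrow> \<bar>s\<bar> \<le> R)"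

lemma bounded_supportI:
  assumes "w \<in> borel_measurable borel" "\<And>s. \<bar>w s\<bar> \<le> B" "\<And>s. w s \<noteq> 0 \<Longrightarrow> \<bar>s\<bar> \<le> R"
  shows "bounded_support w"
  using assms unfolding bounded_support_def by blast

lemma bounded_supportE:
  assumes "bounded_support w"
  obtains B R where "w \<in> borel_measurable borel" "\<And>s. \<bar>w s\<bar> \<le> B" "\<And>s. w s \<noteq> 0 \<Longrightarrow> \<bar>s\<bar> \<le> R"
  using assms unfolding bounded_support_def by blast

lemma bounded_support_continuous:
  assumes "continuous_on UNIV w" and supp: "\<And>s. w s \<noteq> 0 \<Longrightarrow> \<bar>s\<bar> \<le> R"
  shows "bounded_support w"
proof -
  have "compact (w ` {-R..R})"
    using assms(1) by (intro compact_continuous_image) (auto intro: continuous_on_subset)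
  then obtain B where B: "\<And>s. s \<in> {-R..R} \<Longrightarrow> \<bar>w s\<bar> \<le> B"
    using compact_imp_bounded[OF \<open>compact (w ` {-R..R})\<close>] unfolding bounded_real by blast
  have "\<bar>w s\<bar> \<le> \<bar>B\<bar>" for s
    using B[of s] supp[of s] by (cases "w s = 0") (auto simp: abs_le_iff)
  then show ?thesis
    using supp by (rule bounded_supportI[OF borel_measurable_continuous_onI[OF assms(1)]])
qed

lemma bounded_support_shift:
  assumes "bounded_support w" shows "bounded_support (\<lambda>s. w (s - c))"
proof -
  obtain B R where w: "w \<in> borel_measurable borel" "\<And>s. \<bar>w s\<bar> \<le> B" "\<And>s. w s \<noteq> 0 \<Longrightarrow> \<bar>s\<bar> \<le> R"
    using assms by (rule bounded_supportE) blast
  have "(\<lambda>s. w (s - c)) \<in> borel_measurable borel"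
    by (rule measurable_compose[OF _ w(1)]) simp
  moreover have "\<bar>s\<bar> \<le> R + \<bar>c\<bar>" if "w (s - c) \<noteq> 0" for s
    using w(3)[OF that] by linarith
  ultimately show ?thesis using w(2) by (intro bounded_supportI)
qed

definition step :: "'a \<Rightarrow> 'a \<Rightarrow> real \<Rightarrow> 'a" where
  "step l r s = (if s < 0 then l else r)"

lemma bounded_support_step_mult:
  assumes "bounded_support w" shows "bounded_support (\<lambda>s. step l r s * w s)"
proof -
  obtain B R where w[measurable]: "w \<in> borel_measurable borel"
    and w': "\<And>s. \<bar>w s\<bar> \<le> B" "\<And>s. w s \<noteq> 0 \<Longrightarrow> \<bar>s\<bar> \<le> R"
    using assms by (rule bounded_supportE) blast
  have "(\<lambda>s. step l r s * w s) \<in> borel_measurable borel"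
    unfolding step_def by measurable
  moreover have "\<bar>step l r s * w s\<bar> \<le> (\<bar>l\<bar> + \<bar>r\<bar>) * B" for s
    unfolding abs_mult using w'(1) by (intro mult_mono) (auto simp: step_def)
  moreover have "\<bar>s\<bar> \<le> R" if "step l r s * w s \<noteq> 0" for s
    using that w'(2) by simp
  ultimately show ?thesis by (intro bounded_supportI)
qed

text \<open>In the coordinate \<open>x\<^sub>2 - \<nu> t\<close> that moves with a front the integrand separates. For fixed \<open>t\<close> the
  change of coordinate is a translation, so the product of the three integrals remains.\<close>

lemma integral_moving_product:
  fixes u v w :: "real \<Rightarrow> real" and \<nu> :: real
  assumes "bounded_support u" "bounded_support v" "bounded_support w"
  defines "f \<equiv> (\<lambda>p::spacetime. u (fst p) * v (snd p $ 1) * w (snd p $ 2 - \<nu> * fst p))"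
  shows "integrable lebesgue f"
    and "integral\<^sup>L lebesgue f = integral\<^sup>L lborel u * integral\<^sup>L lborel v * integral\<^sup>L lborel w"
proof -
  obtain B1 R1 where u[measurable]: "u \<in> borel_measurable borel"
    and u': "\<And>s. \<bar>u s\<bar> \<le> B1" "\<And>s. u s \<noteq> 0 \<Longrightarrow> \<bar>s\<bar> \<le> R1"
    using assms(1) by (rule bounded_supportE) blast
  obtain B2 R2 where v[measurable]: "v \<in> borel_measurable borel"
    and v': "\<And>s. \<bar>v s\<bar> \<le> B2" "\<And>s. v s \<noteq> 0 \<Longrightarrow> \<bar>s\<bar> \<le> R2"
    using assms(2) by (rule bounded_supportE) blast
  obtain B3 R3 where w[measurable]: "w \<in> borel_measurable borel"
    and w': "\<And>s. \<bar>w s\<bar> \<le> B3" "\<And>s. w s \<noteq> 0 \<Longrightarrow> \<bar>s\<bar> \<le> R3"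
    using assms(3) by (rule bounded_supportE) blast
  have f[measurable]: "f \<in> borel_measurable borel"
    unfolding f_def by measurable
  have B: "0 \<le> B1" "0 \<le> B2" using u'(1)[of 0] v'(1)[of 0] by linarith+
  have bound: "\<bar>f p\<bar> \<le> B1 * B2 * B3" for p
    unfolding f_def abs_mult using B u' v' w' by (intro mult_mono) auto
  define R where "R = \<bar>R1\<bar> + \<bar>R2\<bar> + \<bar>R3\<bar> + \<bar>\<nu>\<bar> * \<bar>R1\<bar>"
  have "0 \<le> \<bar>\<nu>\<bar> * \<bar>R1\<bar>" by simp
  then have R: "R1 \<le> R" "R2 \<le> R" "R3 + \<bar>\<nu>\<bar> * \<bar>R1\<bar> \<le> R"
    unfolding R_def by linarith+
  have supp: "\<bar>t\<bar> \<le> R \<and> \<bar>x $ 1\<bar> \<le> R \<and> \<bar>x $ 2\<bar> \<le> R" if "f (t, x) \<noteq> 0" for t x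
  proof -
    have *: "\<bar>t\<bar> \<le> R1" "\<bar>x $ 1\<bar> \<le> R2" "\<bar>x $ 2 - \<nu> * t\<bar> \<le> R3"
      using that u' v' w' by (auto simp: f_def)
    have "\<bar>\<nu> * t\<bar> \<le> \<bar>\<nu>\<bar> * \<bar>R1\<bar>"
      unfolding abs_mult using *(1) by (intro mult_left_mono) auto
    moreover have "\<bar>x $ 2\<bar> \<le> \<bar>x $ 2 - \<nu> * t\<bar> + \<bar>\<nu> * t\<bar>"
      by linarith
    ultimately have "\<bar>x $ 2\<bar> \<le> R"
      using *(3) R(3) by linarith
    then show ?thesis using order_trans[OF *(1) R(1)] order_trans[OF *(2) R(2)] by blast
  qed
  have "integrable lborel f"
  proof (rule integrable_bounded_support[OF f bound])
    fix p assume "f p \<noteq> 0"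
    with supp[of "fst p" "snd p"] show "p \<in> cbox (-R, vector [-R, -R]) (R, vector [R, R])"
      by (cases p) (auto simp: abs_le_iff mem_box_cart forall_2)
  qed
  then show "integrable lebesgue f" by (simp add: integrable_completion)
  have "(LINT y|lborel. w (y - c)) = integral\<^sup>L lborel w" for c
    using lborel_integral_real_affine[of 1 w "- c"] by simp
  then show "integral\<^sup>L lebesgue f = integral\<^sup>L lborel u * integral\<^sup>L lborel v * integral\<^sup>L lborel w"
    by (subst integral_spacetime_iterated[OF f bound supp]) (simp_all add: f_def mult.assoc)
qed

lemma bounded_support_bump: "bounded_support bump"
  by (rule bounded_support_continuous[OF continuous_bump, of 1]) (metis bump_eq_0 linear)

lemma bounded_support_deriv_bump: "bounded_support (deriv bump)"
  by (rule bounded_support_continuous[OF continuous_deriv_bump, of 1]) (metis deriv_bump_eq_0 not_le)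

text \<open>The distributional derivative of a step is its height times a point mass at the jump.\<close>

lemma integral_step_deriv_bump: "(LINT s|lborel. step l r s * deriv bump s) = (l - r) * bump 0"
proof -
  have cont: "isCont (deriv bump) s" for s
    using continuous_deriv_bump[of UNIV] by (simp add: continuous_on_eq_continuous_at)
  have i1: "has_bochner_integral lborel (\<lambda>s. deriv bump s * indicator {-1..0} s) (bump 0 - bump (-1))"
    by (rule has_bochner_integral_FTC_Icc_real) (auto intro: bump_DERIV cont)
  have i2: "has_bochner_integral lborel (\<lambda>s. deriv bump s * indicator {0..1} s) (bump 1 - bump 0)"
    by (rule has_bochner_integral_FTC_Icc_real) (auto intro: bump_DERIV cont)
  have "has_bochner_integral lborel (\<lambda>s. l * (deriv bump s * indicator {-1..0} s) + r * (deriv bump s * indicator {0..1} s))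
      (l * (bump 0 - bump (-1)) + r * (bump 1 - bump 0))"
    by (intro has_bochner_integral_add has_bochner_integral_mult_right i1 i2)
  moreover have "AE s in lborel. l * (deriv bump s * indicator {-1..0} s) + r * (deriv bump s * indicator {0..1} s) = step l r s * deriv bump s"
    using AE_lborel_singleton[of 0]
  proof eventually_elim
    case (elim s)
    then show ?case
      using deriv_bump_eq_0[of s] by (cases "1 < \<bar>s\<bar>") (auto simp: step_def indicator_def)
  qed
  moreover have "(\<lambda>s. step l r s * deriv bump s) \<in> borel_measurable lborel"
    using bounded_support_step_mult[OF bounded_support_deriv_bump] by (simp add: bounded_support_def)
  ultimately have "has_bochner_integral lborel (\<lambda>s. step l r s * deriv bump s) (l * (bump 0 - bump (-1)) + r * (bump 1 - bump 0))"
    using has_bochner_integralI_AE by blast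
  then show ?thesis
    using bump_eq_0[of 1] bump_eq_0[of "-1"] by (simp add: has_bochner_integral_iff algebra_simps)
qed

lemma integral_deriv_bump: "integral\<^sup>L lborel (deriv bump) = 0"
  using integral_step_deriv_bump[of 1 1] by (simp add: step_def)

lemma integral_bump_pos: "0 < integral\<^sup>L lborel bump"
proof -
  have "continuous_on {-1/2..1/2} bump" by (rule continuous_bump)
  then obtain m where m: "m \<in> {-1/2..1/2}" "\<And>s. s \<in> {-1/2..1/2} \<Longrightarrow> bump m \<le> bump s"
    using continuous_attains_inf[of "{-1/2..1/2::real}" bump] by auto
  have "0 < bump m" using m(1) by (intro bump_pos) auto
  obtain B where "bump \<in> borel_measurable borel" "\<And>s. \<bar>bump s\<bar> \<le> B"
    using bounded_support_bump by (rule bounded_supportE) blast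
  then have "integrable lborel bump"
  proof (rule integrable_bounded_support)
    show "s \<in> cbox (-1) 1" if "bump s \<noteq> 0" for s
      using that bump_eq_0[of s] by (cases "1 \<le> \<bar>s\<bar>") auto
  qed
  moreover have "integrable lborel (\<lambda>s. bump m * indicator {-1/2..1/2::real} s)"
    by (intro integrable_mult_right integrable_real_indicator) auto
  moreover have "bump m * indicator {-1/2..1/2::real} s \<le> bump s" for s
    using m(2)[of s] bump_nonneg[of s] by (auto simp: indicator_def)
  ultimately have "(LINT s|lborel. bump m * indicator {-1/2..1/2::real} s) \<le> integral\<^sup>L lborel bump"
    by (intro integral_mono)
  then show ?thesis using \<open>0 < bump m\<close> by simp
qed


section \<open>Rankine--Hugoniot conditions from the weak formulation\<close>

text \<open>Tested with a travelling bump, a conservation law becomes a sum of separated integrals. Terms with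
  the derivative of the bump in \<open>t\<close> or in \<open>x\<^sub>1\<close> integrate to zero, and the derivative across
  the front picks out the jump of \<open>F\<^sub>2 - \<nu> U\<close>. Since the fields are piecewise constant only off the
  front itself, integrands are compared almost everywhere.\<close>

lemma jump_condition:
  assumes weak: "\<And>\<phi>. \<phi> \<in> test_functions \<infinity> \<Longrightarrow> weak_form 0 \<infinity> U F U\<^sub>0 \<phi> = 0"
    and T: "1 < T"
    and near: "\<And>t x. \<bar>t - T\<bar> \<le> 1 \<Longrightarrow> \<bar>x $ 2 - \<nu> * t\<bar> \<le> 1 \<Longrightarrow> x $ 2 \<noteq> \<nu> * t \<Longrightarrow>
      U (t, x) = step Ul Ur (x $ 2 - \<nu> * t) \<and> F (t, x) = step Fl Fr (x $ 2 - \<nu> * t)"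
  shows "\<nu> * (Ul - Ur) = Fl $ 2 - Fr $ 2"
proof -
  let ?\<phi> = "travelling_bump \<nu> T"
  let ?u = "\<lambda>s. bump (s - T)" and ?u' = "\<lambda>s. deriv bump (s - T)"
  define P where "P u v w = (\<lambda>p::spacetime. u (fst p) * v (snd p $ 1) * w (snd p $ 2 - \<nu> * fst p) :: real)"
    for u v w :: "real \<Rightarrow> real"
  have bu: "bounded_support ?u" "bounded_support ?u'"
    using bounded_support_shift bounded_support_bump bounded_support_deriv_bump by blast+
  note PI = integral_moving_product[where \<nu>=\<nu>, folded P_def]
  \<comment> \<open>In order: the time derivative of the profile in time, the time derivative that comes from the
    motion of the front, the flux along the front, and the flux across it.\<close>
  let ?P1 = "P ?u' bump (\<lambda>s. step Ul Ur s * bump s)"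
  let ?P2 = "P ?u bump (\<lambda>s. step Ul Ur s * deriv bump s)"
  let ?P3 = "P ?u (deriv bump) (\<lambda>s. step (Fl $ 1) (Fr $ 1) s * bump s)"
  let ?P4 = "P ?u bump (\<lambda>s. step (Fl $ 2) (Fr $ 2) s * deriv bump s)"
  note I = PI(1)[OF bu(2) bounded_support_bump bounded_support_step_mult[OF bounded_support_bump], of Ul Ur]
    PI(1)[OF bu(1) bounded_support_bump bounded_support_step_mult[OF bounded_support_deriv_bump], of Ul Ur]
    PI(1)[OF bu(1) bounded_support_deriv_bump bounded_support_step_mult[OF bounded_support_bump], of "Fl $ 1" "Fr $ 1"]
    PI(1)[OF bu(1) bounded_support_bump bounded_support_step_mult[OF bounded_support_deriv_bump], of "Fl $ 2" "Fr $ 2"]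
  note E = PI(2)[OF bu(2) bounded_support_bump bounded_support_step_mult[OF bounded_support_bump], of Ul Ur]
    PI(2)[OF bu(1) bounded_support_bump bounded_support_step_mult[OF bounded_support_deriv_bump], of Ul Ur]
    PI(2)[OF bu(1) bounded_support_deriv_bump bounded_support_step_mult[OF bounded_support_bump], of "Fl $ 1" "Fr $ 1"]
    PI(2)[OF bu(1) bounded_support_bump bounded_support_step_mult[OF bounded_support_deriv_bump], of "Fl $ 2" "Fr $ 2"]
  have shift: "(LINT s|lborel. g (s - T)) = integral\<^sup>L lborel g" for g :: "real \<Rightarrow> real"
    using lborel_integral_real_affine[of 1 g "- T"] by simp
  let ?G = "\<lambda>p. ?P1 p - \<nu> * ?P2 p + ?P3 p + ?P4 p"
  have "AE p in lebesgue. indicator (strip 0 \<infinity>) p *\<^sub>R (U p * dt ?\<phi> p + F p \<bullet> grad ?\<phi> p) = ?G p"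
    using AE_not_moving_plane[of \<nu>]
  proof eventually_elim
    case (elim p)
    obtain t x where p: "p = (t, x)" by (cases p)
    show ?case
    proof (cases "\<bar>t - T\<bar> \<le> 1 \<and> \<bar>x $ 2 - \<nu> * t\<bar> \<le> 1")
      case True
      then have "p \<in> strip 0 \<infinity>" using T by (auto simp: p strip_def before_def)
      moreover have "U p = step Ul Ur (x $ 2 - \<nu> * t)" "F p = step Fl Fr (x $ 2 - \<nu> * t)"
        using near[of t x] True elim by (auto simp: p)
      ultimately show ?thesis
        by (simp add: p P_def inner_vec_def sum_2 dt_travelling_bump grad_travelling_bump step_def algebra_simps)
    next
      case False
      then have "bump (t - T) = 0 \<and> deriv bump (t - T) = 0 \<or>
          bump (x $ 2 - \<nu> * t) = 0 \<and> deriv bump (x $ 2 - \<nu> * t) = 0"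
        using bump_eq_0 deriv_bump_eq_0 by (meson less_imp_le not_le)
      then show ?thesis
        by (auto simp: p P_def inner_vec_def sum_2 dt_travelling_bump grad_travelling_bump)
    qed
  qed
  moreover have "?G \<in> borel_measurable lebesgue"
    by (intro borel_measurable_add borel_measurable_diff borel_measurable_times borel_measurable_const
        I[THEN borel_measurable_integrable])
  ultimately have "(LINT p:strip 0 \<infinity>|lebesgue. U p * dt ?\<phi> p + F p \<bullet> grad ?\<phi> p) = integral\<^sup>L lebesgue ?G"
    unfolding set_lebesgue_integral_def
    by (rule integral_cong_AE_lebesgue)
  also have "\<dots> = integral\<^sup>L lebesgue ?P1 - \<nu> * integral\<^sup>L lebesgue ?P2 + integral\<^sup>L lebesgue ?P3 + integral\<^sup>L lebesgue ?P4"
    using I by simp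
  also have "\<dots> = (integral\<^sup>L lborel bump)\<^sup>2 * bump 0 * ((Fl $ 2 - Fr $ 2) - \<nu> * (Ul - Ur))"
    unfolding E shift[of bump] shift[of "deriv bump"] integral_deriv_bump integral_step_deriv_bump by (simp add: power2_eq_square algebra_simps)
  finally have "weak_form 0 \<infinity> U F U\<^sub>0 ?\<phi> = (integral\<^sup>L lborel bump)\<^sup>2 * bump 0 * ((Fl $ 2 - Fr $ 2) - \<nu> * (Ul - Ur))"
    using T by (simp add: weak_form_def travelling_bump_def bump_eq_0)
  then show ?thesis
    using weak[OF travelling_bump_test_function, of \<nu> T] integral_bump_pos bump_pos[of 0] by simp
qed

text \<open>Both fronts of a fan are reached with the same \<open>T\<close>, chosen so large that around this time they are
  more than one unit apart, which is the half-width of a travelling bump.\<close>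

lemma fan_jump_conditions:
  assumes law: "conservation_law 0 \<infinity> U F U\<^sub>0" and "x < y"
    and UF: "\<And>t z. 0 < t \<Longrightarrow> z $ 2 \<noteq> x * t \<Longrightarrow> z $ 2 \<noteq> y * t \<Longrightarrow>
      U (t, z) = fan x y Um U1 Up (t, z) \<and> F (t, z) = fan x y Fm F1 Fp (t, z)"
  shows "x * (Um - U1) = Fm $ 2 - F1 $ 2" and "y * (Up - U1) = Fp $ 2 - F1 $ 2"
proof -
  have weak: "weak_form 0 \<infinity> U F U\<^sub>0 \<phi> = 0" if "\<phi> \<in> test_functions \<infinity>" for \<phi>
    using law that by (simp add: conservation_law_def)
  define T where "T = 2 + 2 / (y - x)"
  have "1 < T" using \<open>x < y\<close> by (simp add: T_def add_pos_pos)
  have sep: "0 < t \<and> x * t + 1 < y * t" if "\<bar>t - T\<bar> \<le> 1" for t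
  proof -
    have "0 < 2 / (y - x)" using \<open>x < y\<close> by simp
    then have "2 / (y - x) < t" using that unfolding T_def by linarith
    with \<open>0 < 2 / (y - x)\<close> have "0 < t" by linarith
    moreover from \<open>2 / (y - x) < t\<close> have "2 < t * (y - x)" using \<open>x < y\<close> by (simp add: pos_divide_less_eq)
    ultimately show ?thesis by (simp add: algebra_simps)
  qed
  have "x * (Um - U1) = Fm $ 2 - F1 $ 2"
  proof (rule jump_condition[OF weak \<open>1 < T\<close>])
    fix t and z :: "real^2"
    assume "\<bar>t - T\<bar> \<le> 1" "\<bar>z $ 2 - x * t\<bar> \<le> 1" "z $ 2 \<noteq> x * t"
    then show "U (t, z) = step Um U1 (z $ 2 - x * t) \<and> F (t, z) = step Fm F1 (z $ 2 - x * t)"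
      using sep[of t] UF[of t z] by (auto simp: fan_def step_def)
  qed
  then show "x * (Um - U1) = Fm $ 2 - F1 $ 2" .
  have "y * (U1 - Up) = F1 $ 2 - Fp $ 2"
  proof (rule jump_condition[OF weak \<open>1 < T\<close>])
    fix t and z :: "real^2"
    assume "\<bar>t - T\<bar> \<le> 1" "\<bar>z $ 2 - y * t\<bar> \<le> 1" "z $ 2 \<noteq> y * t"
    then show "U (t, z) = step U1 Up (z $ 2 - y * t) \<and> F (t, z) = step F1 Fp (z $ 2 - y * t)"
      using sep[of t] UF[of t z] by (auto simp: fan_def step_def)
  qed
  then show "y * (Up - U1) = Fp $ 2 - F1 $ 2" by (simp add: algebra_simps)
qed

lemma vert_component [simp]: "vert a $ 1 = 0" "vert a $ 2 = a"
  by (simp_all add: vert_def)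

lemma norm_vec2_sq: "(norm (a :: real^2))\<^sup>2 = (a $ 1)\<^sup>2 + (a $ 2)\<^sup>2"
  unfolding power2_norm_eq_inner by (simp add: inner_vec_def sum_2 power2_eq_square)

lemma two_shock_Rankine_Hugoniot:
  assumes "is_two_shock D R V X Y"
  shows "X * (rho_minus D - R) = rho_minus D * v_minus D - R * V"
    and "Y * (rho_plus D - R) = rho_plus D * v_plus D - R * V"
    and "X * (rho_minus D * v_minus D - R * V)
      = rho_minus D * (v_minus D)\<^sup>2 - R * V\<^sup>2 + (rho_minus D)\<^sup>2 - R\<^sup>2"
    and "Y * (rho_plus D * v_plus D - R * V)
      = rho_plus D * (v_plus D)\<^sup>2 - R * V\<^sup>2 + (rho_plus D)\<^sup>2 - R\<^sup>2"
proof -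
  define r where "r = dens (two_shock D R V X Y)"
  define v where "v = vel (two_shock D R V X Y)"
  have xy: "X < Y" and mass: "conservation_law 0 \<infinity> r (\<lambda>p. r p *\<^sub>R v p) (init_rho D)"
    and mom: "conservation_law 0 \<infinity> (\<lambda>p. r p * v p $ 2) (\<lambda>p. (r p * v p $ 2) *\<^sub>R v p + pressure (r p) *\<^sub>R axis 2 1)
        (\<lambda>x. init_rho D x * init_vel D x $ 2)"
    using assms by (auto simp: is_two_shock_def entropic_solution_def r_def v_def)
  have "r p = fan X Y (rho_minus D) R (rho_plus D) p \<and> r p *\<^sub>R v p =
      fan X Y (rho_minus D *\<^sub>R vert (v_minus D)) (R *\<^sub>R vert V) (rho_plus D *\<^sub>R vert (v_plus D)) p" for p
    by (simp add: r_def v_def two_shock_def fan_def split: prod.split)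
  from fan_jump_conditions[OF mass xy this]
  show "X * (rho_minus D - R) = rho_minus D * v_minus D - R * V"
    and "Y * (rho_plus D - R) = rho_plus D * v_plus D - R * V"
    by simp_all
  define flux where "flux a b = (a * b) *\<^sub>R vert b + pressure a *\<^sub>R axis 2 1" for a b
  have "r p * v p $ 2 = fan X Y (rho_minus D * v_minus D) (R * V) (rho_plus D * v_plus D) p \<and>
    (r p * v p $ 2) *\<^sub>R v p + pressure (r p) *\<^sub>R axis 2 1 =
      fan X Y (flux (rho_minus D) (v_minus D)) (flux R V) (flux (rho_plus D) (v_plus D)) p" for p
    by (simp add: r_def v_def two_shock_def fan_def flux_def split: prod.split)
  from fan_jump_conditions[OF mom xy this]
  show "X * (rho_minus D * v_minus D - R * V)
      = rho_minus D * (v_minus D)\<^sup>2 - R * V\<^sup>2 + (rho_minus D)\<^sup>2 - R\<^sup>2"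
    and "Y * (rho_plus D * v_plus D - R * V)
      = rho_plus D * (v_plus D)\<^sup>2 - R * V\<^sup>2 + (rho_plus D)\<^sup>2 - R\<^sup>2"
    by (simp_all add: flux_def pressure_def axis_def power2_eq_square algebra_simps)
qed

lemma fan_kin_eq_fan:
  assumes "nu_minus F < nu_plus F" "0 < t" "z $ 2 \<noteq> nu_minus F * t" "z $ 2 \<noteq> nu_plus F * t"
  shows "fan_kin D F (t, z) = fan (nu_minus F) (nu_plus F)
    (rho_minus D * (v_minus D)\<^sup>2 / 2) (CC F * rho1 F / 2) (rho_plus D * (v_plus D)\<^sup>2 / 2) (t, z)"
proof -
  have "nu_minus F * t < nu_plus F * t" using assms by simp
  then show ?thesis
    using assms by (auto simp: fan_kin_def fan_rho_def fan_v_def fan_def mid_def sides_def P_mid_def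
        P_minus_def P_plus_def indicator_def norm_vec2_sq)
qed

text \<open>The vertical momentum flux of the middle state is
  \<open>rho1 F * K\<close> plus pressure with \<open>K = CC F - eps2 F\<close>, whereas the energy of the middle state involves
  \<open>CC F\<close>. The balance laws therefore do not feel \<open>eps2 F\<close>; the action does.\<close>

lemma fan_subsolution_Rankine_Hugoniot:
  fixes F :: fan_state
  assumes "fan_subsolution D F"
  defines "\<beta> \<equiv> v1 F $ 2" and "K \<equiv> CC F - eps2 F"
  shows "nu_minus F * (rho_minus D - rho1 F) = rho_minus D * v_minus D - rho1 F * \<beta>"
    and "nu_plus F * (rho_plus D - rho1 F) = rho_plus D * v_plus D - rho1 F * \<beta>"
    and "nu_minus F * (rho_minus D * v_minus D - rho1 F * \<beta>)
      = rho_minus D * (v_minus D)\<^sup>2 - rho1 F * K + (rho_minus D)\<^sup>2 - (rho1 F)\<^sup>2"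
    and "nu_plus F * (rho_plus D * v_plus D - rho1 F * \<beta>)
      = rho_plus D * (v_plus D)\<^sup>2 - rho1 F * K + (rho_plus D)\<^sup>2 - (rho1 F)\<^sup>2"
proof -
  define x where "x = nu_minus F"
  define y where "y = nu_plus F"
  have xy: "x < y" and u1: "u1 F \<in> sym_tracefree"
    and mass: "conservation_law 0 \<infinity> (fan_rho D F) (\<lambda>p. fan_rho D F p *\<^sub>R fan_v D F p) (init_rho D)"
    and mom: "conservation_law 0 \<infinity> (\<lambda>p. fan_rho D F p * fan_v D F p $ 2)
        (\<lambda>p. fan_rho D F p *\<^sub>R (fan_u D F p $ 2)
             + (pressure (fan_rho D F p) + fan_kin D F p) *\<^sub>R axis 2 1)
        (\<lambda>x. init_rho D x * init_vel D x $ 2)"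
    using assms by (auto simp: fan_subsolution_def x_def y_def)
  have u22: "u1 F $ 2 $ 2 = - u1 F $ 1 $ 1"
    using u1 by (simp add: sym_tracefree_def trace_def sum_2)
  have "fan_rho D F p = fan x y (rho_minus D) (rho1 F) (rho_plus D) p \<and> fan_rho D F p *\<^sub>R fan_v D F p =
      fan x y (rho_minus D *\<^sub>R vert (v_minus D)) (rho1 F *\<^sub>R v1 F) (rho_plus D *\<^sub>R vert (v_plus D)) p" for p
    by (simp add: fan_rho_def fan_v_def x_def y_def fan_def split: prod.split)
  from fan_jump_conditions[OF mass xy this]
  show "nu_minus F * (rho_minus D - rho1 F) = rho_minus D * v_minus D - rho1 F * \<beta>"
    and "nu_plus F * (rho_plus D - rho1 F) = rho_plus D * v_plus D - rho1 F * \<beta>"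
    by (simp_all add: x_def y_def \<beta>_def)
  define flux where "flux a u k = a *\<^sub>R (u $ 2) + (pressure a + k) *\<^sub>R axis 2 1"
    for a k :: real and u :: "real^2^2"
  let ?fm = "flux (rho_minus D) (outer_state (vert (v_minus D))) (rho_minus D * (v_minus D)\<^sup>2 / 2)"
  let ?fp = "flux (rho_plus D) (outer_state (vert (v_plus D))) (rho_plus D * (v_plus D)\<^sup>2 / 2)"
  let ?f1 = "flux (rho1 F) (u1 F) (CC F * rho1 F / 2)"
  have UF: "fan_rho D F (t, z) * fan_v D F (t, z) $ 2 =
      fan x y (rho_minus D * v_minus D) (rho1 F * \<beta>) (rho_plus D * v_plus D) (t, z) \<and>
    fan_rho D F (t, z) *\<^sub>R (fan_u D F (t, z) $ 2) + (pressure (fan_rho D F (t, z)) + fan_kin D F (t, z)) *\<^sub>R axis 2 1 =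
      fan x y ?fm ?f1 ?fp (t, z)" if "0 < t" "z $ 2 \<noteq> x * t" "z $ 2 \<noteq> y * t" for t z
    using fan_kin_eq_fan[of F t z D] that xy
    by (simp add: fan_rho_def fan_v_def fan_u_def x_def y_def fan_def flux_def \<beta>_def)
  have os: "outer_state (vert a) $ 2 $ 2 = a\<^sup>2 / 2" for a
    by (simp add: outer_state_def outer_def mat_def norm_vec2_sq, simp add: power2_eq_square)
  from fan_jump_conditions[OF mom xy UF]
  have "x * (rho_minus D * v_minus D - rho1 F * \<beta>) = ?fm $ 2 - ?f1 $ 2"
    and "y * (rho_plus D * v_plus D - rho1 F * \<beta>) = ?fp $ 2 - ?f1 $ 2"
    by simp_all
  then show "nu_minus F * (rho_minus D * v_minus D - rho1 F * \<beta>)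
      = rho_minus D * (v_minus D)\<^sup>2 - rho1 F * K + (rho_minus D)\<^sup>2 - (rho1 F)\<^sup>2"
    and "nu_plus F * (rho_plus D * v_plus D - rho1 F * \<beta>)
      = rho_plus D * (v_plus D)\<^sup>2 - rho1 F * K + (rho_plus D)\<^sup>2 - (rho1 F)\<^sup>2"
    by (auto simp: flux_def os u22 K_def eps2_def pressure_def x_def y_def axis_def algebra_simps)
qed


section \<open>Comparison of the second-order coefficients\<close>

text \<open>How fast the integral over a fixed window of a field with the values \<open>cm, c1, cp\<close> grows, when the
  fronts between these values move with the speeds \<open>x\<close> and \<open>y\<close>.\<close>

definition fan_excess :: "real \<Rightarrow> real \<Rightarrow> real \<Rightarrow> real \<Rightarrow> real \<Rightarrow> real" where
  "fan_excess x y cm c1 cp = x * cm - y * cp + (y - x) * c1"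

text \<open>By mass and momentum balance the moments of order 0, 1, 2 of the signed measure with mass \<open>b\<close> at \<open>y\<close>
  and \<open>- a\<close> at \<open>x\<close> are fixed by the outer states. Hence the measure \<open>\<mu>\<close> with masses \<open>b, - a, - B, A\<close> at
  \<open>y, x, Y, X\<close> annihilates all quadratic polynomials. Its third moment is the integral of any
  monic cubic polynomial; choosing the one with the roots \<open>x, X, Y\<close> leaves the single term
  \<open>b * (y - x) * (y - X) * (y - Y)\<close>, whose sign is read off once \<open>Y \<le> y\<close> is known. The
  three moments also determine \<open>a * b * (y - x)\<^sup>2\<close>. Since \<open>a * b\<close> grows with the density, \<open>y - x\<close>
  shrinks, but only like the inverse square root of \<open>a * b\<close>, so that \<open>a * b * (y - x)\<close> grows.\<close>

lemma third_moment_antimono: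
  fixes a b x y A B X Y h :: real
  assumes pos: "0 < a" "0 < b" "0 \<le> h" and AB: "A = a + h" "B = b + h"
    and lt: "x < y" "X < Y"
    and m1: "B * Y - A * X = b * y - a * x"
    and m2: "B * Y\<^sup>2 - A * X\<^sup>2 = b * y\<^sup>2 - a * x\<^sup>2"
  shows "B * Y ^ 3 - A * X ^ 3 \<le> b * y ^ 3 - a * x ^ 3"
    and "a * b * (y - x) \<le> A * B * (Y - X)"
proof -
  have BA: "B = b - a + A" using AB by simp
  \<comment> \<open>Both sides are the squared first moment minus the product of the zeroth and the second.\<close>
  have disc: "a * b * (y - x)\<^sup>2 = A * B * (Y - X)\<^sup>2"
    using BA m1 m2 by algebra
  have "a * b \<le> A * B" using pos AB by (simp add: mult_mono)
  show 1: "B * Y ^ 3 - A * X ^ 3 \<le> b * y ^ 3 - a * x ^ 3"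
  proof -
    have yY: "Y \<le> y"
    proof (rule ccontr)
      assume "\<not> Y \<le> y"
      then have "y < Y" by simp
      \<comment> \<open>The integral against \<open>\<mu>\<close> of the quadratic polynomial with the roots \<open>x\<close> and \<open>Y\<close>.\<close>
      have "b * (y - x) * (y - Y) = A * (X - x) * (Y - X)"
        using BA m1 m2 by algebra
      moreover have "b * (y - x) * (y - Y) < 0"
        using \<open>y < Y\<close> pos lt by (simp add: mult_pos_neg)
      moreover have "0 < A" using pos AB by simp
      ultimately have "X < x"
        using lt by (smt (verit) mult_nonneg_nonneg)
      then have "(y - x)\<^sup>2 < (Y - X)\<^sup>2" using \<open>y < Y\<close> lt by (intro power_strict_mono) auto
      then have "a * b * (y - x)\<^sup>2 < A * B * (Y - X)\<^sup>2"
        using \<open>a * b \<le> A * B\<close> pos by (smt (verit) mult_pos_pos mult_strict_left_mono mult_right_mono zero_le_power2)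
      with disc show False by simp
    qed
    \<comment> \<open>The integral against \<open>\<mu>\<close> of the cubic polynomial with the roots \<open>x, X, Y\<close>.\<close>
    have "b * y ^ 3 - a * x ^ 3 - (B * Y ^ 3 - A * X ^ 3) = b * (y - x) * (y - X) * (y - Y)"
      using BA m1 m2 by algebra
    also have "\<dots> \<ge> 0" using pos lt yY by simp
    finally show ?thesis by simp
  qed
  have AB_pos: "0 < A" "0 < B" using pos AB by auto
  have "(a * b * (y - x))\<^sup>2 = (a * b) * (a * b * (y - x)\<^sup>2)"
    by (simp add: power2_eq_square)
  also have "\<dots> \<le> (A * B) * (a * b * (y - x)\<^sup>2)"
    using \<open>a * b \<le> A * B\<close> pos by (intro mult_right_mono) auto
  also have "\<dots> = (A * B * (Y - X))\<^sup>2"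
    unfolding disc by (simp add: power2_eq_square)
  finally show "a * b * (y - x) \<le> A * B * (Y - X)"
    by (rule power2_le_imp_le) (use AB_pos lt in simp)
qed

text \<open>The excess of the Lagrangian, with \<open>K\<close> as squared speed of the middle state. The momentum balance
  removes \<open>K\<close> and the mass balance removes \<open>\<beta>\<close>. What remains is the third moment, a constant of the outer
  states, and the term \<open>(r - rm) * (r - rp) * (y - x)\<close>, exactly the quantities that
  \<open>third_moment_antimono\<close> controls.\<close>

lemma fan_excess_eq_moments:
  fixes rm rp vm vp r \<beta> K x y :: real
  assumes mm: "x * (rm - r) = rm * vm - r * \<beta>"
    and mp: "y * (rp - r) = rp * vp - r * \<beta>"
    and pm: "x * (rm * vm - r * \<beta>) = rm * vm\<^sup>2 - r * K + rm\<^sup>2 - r\<^sup>2"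
    and pp: "y * (rp * vp - r * \<beta>) = rp * vp\<^sup>2 - r * K + rp\<^sup>2 - r\<^sup>2"
  shows "2 * fan_excess x y (rm * vm\<^sup>2 / 2 - rm\<^sup>2) (r * K / 2 - r\<^sup>2) (rp * vp\<^sup>2 / 2 - rp\<^sup>2)
    = ((r - rp) * y ^ 3 - (r - rm) * x ^ 3)
      - 3 * ((rm + rp) * (rm * vm - rp * vp) + (r - rm) * (r - rp) * (y - x))"
proof -
  have "2 * fan_excess x y (rm * vm\<^sup>2 / 2 - rm\<^sup>2) (r * K / 2 - r\<^sup>2) (rp * vp\<^sup>2 / 2 - rp\<^sup>2)
     = x * (rm * vm\<^sup>2 - r * K + rm\<^sup>2 - r\<^sup>2) - y * (rp * vp\<^sup>2 - r * K + rp\<^sup>2 - r\<^sup>2)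
       - 3 * (x * (rm\<^sup>2 - r\<^sup>2) - y * (rp\<^sup>2 - r\<^sup>2))"
    by (simp add: fan_excess_def field_simps)
  also have "\<dots> = x * (x * (x * (rm - r))) - y * (y * (y * (rp - r)))
       - 3 * (x * (rm\<^sup>2 - r\<^sup>2) - y * (rp\<^sup>2 - r\<^sup>2))"
    unfolding pm[symmetric] pp[symmetric] mm mp ..
  also have "x * (rm\<^sup>2 - r\<^sup>2) - y * (rp\<^sup>2 - r\<^sup>2)
      = (rm + rp) * (x * (rm - r) - y * (rp - r)) + (r - rm) * (r - rp) * (y - x)"
    by (simp add: power2_eq_square algebra_simps)
  also have "x * (rm - r) - y * (rp - r) = rm * vm - rp * vp"
    unfolding mm mp by simp
  finally show ?thesis by (simp add: power3_eq_cube algebra_simps)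
qed

text \<open>Two effects, both in favour of the shocks: at squared speed \<open>K\<close> the excess decreases with the
  density of the middle state, and the kinetic energy of the actual squared speed \<open>C\<close> exceeds that of \<open>K\<close>.\<close>

lemma fan_excess_two_shock_less:
  fixes rm rp vm vp r \<beta> K C x y R V X Y :: real
  assumes dens: "rm < r" "rp < r" "r \<le> R" "0 < r" and xy: "x < y" "X < Y" and "K < C"
    and mm: "x * (rm - r) = rm * vm - r * \<beta>"
    and mp: "y * (rp - r) = rp * vp - r * \<beta>"
    and pm: "x * (rm * vm - r * \<beta>) = rm * vm\<^sup>2 - r * K + rm\<^sup>2 - r\<^sup>2"
    and pp: "y * (rp * vp - r * \<beta>) = rp * vp\<^sup>2 - r * K + rp\<^sup>2 - r\<^sup>2"
    and MM: "X * (rm - R) = rm * vm - R * V"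
    and MP: "Y * (rp - R) = rp * vp - R * V"
    and PM: "X * (rm * vm - R * V) = rm * vm\<^sup>2 - R * V\<^sup>2 + rm\<^sup>2 - R\<^sup>2"
    and PP: "Y * (rp * vp - R * V) = rp * vp\<^sup>2 - R * V\<^sup>2 + rp\<^sup>2 - R\<^sup>2"
  shows "fan_excess X Y (rm * vm\<^sup>2 / 2 - rm\<^sup>2) (R * V\<^sup>2 / 2 - R\<^sup>2) (rp * vp\<^sup>2 / 2 - rp\<^sup>2)
    < fan_excess x y (rm * vm\<^sup>2 / 2 - rm\<^sup>2) (r * C / 2 - r\<^sup>2) (rp * vp\<^sup>2 / 2 - rp\<^sup>2)"
    (is "?J < _")
proof -
  have 0: "0 < r - rm" "0 < r - rp" "0 \<le> R - r" "R - rm = (r - rm) + (R - r)" "R - rp = (r - rp) + (R - r)"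
    using dens by auto
  have 1: "(R - rp) * Y - (R - rm) * X = (r - rp) * y - (r - rm) * x"
    using mm mp MM MP by (simp add: algebra_simps)
  have e: "(r - rp) * y\<^sup>2 - (r - rm) * x\<^sup>2 = rm * vm\<^sup>2 + rm\<^sup>2 - rp * vp\<^sup>2 - rp\<^sup>2"
    using pm[folded mm] pp[folded mp] by (simp add: power2_eq_square algebra_simps)
  have E: "(R - rp) * Y\<^sup>2 - (R - rm) * X\<^sup>2 = rm * vm\<^sup>2 + rm\<^sup>2 - rp * vp\<^sup>2 - rp\<^sup>2"
    using PM[folded MM] PP[folded MP] by (simp add: power2_eq_square algebra_simps)
  note m = third_moment_antimono[OF 0 xy 1 E[folded e]]
  have "2 * ?J \<le> 2 * fan_excess x y (rm * vm\<^sup>2 / 2 - rm\<^sup>2) (r * K / 2 - r\<^sup>2) (rp * vp\<^sup>2 / 2 - rp\<^sup>2)"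
    unfolding fan_excess_eq_moments[OF mm mp pm pp] fan_excess_eq_moments[OF MM MP PM PP]
    by (intro diff_mono mult_left_mono add_left_mono m) auto
  then have "?J \<le> fan_excess x y (rm * vm\<^sup>2 / 2 - rm\<^sup>2) (r * K / 2 - r\<^sup>2) (rp * vp\<^sup>2 / 2 - rp\<^sup>2)"
    by simp
  also have "\<dots> < fan_excess x y (rm * vm\<^sup>2 / 2 - rm\<^sup>2) (r * C / 2 - r\<^sup>2) (rp * vp\<^sup>2 / 2 - rp\<^sup>2)"
    using \<open>x < y\<close> \<open>K < C\<close> \<open>0 < r\<close> by (simp add: fan_excess_def)
  finally show ?thesis .
qed


section \<open>The action at small times\<close>

lemma integral_three_step:
  fixes l1 l2 x y cm c1 cp :: real
  assumes "l1 \<le> x" "x \<le> y" "y \<le> l2"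
  shows "(LINT s|lborel. indicator {l1..l2} s * (if s < x then cm else if s < y then c1 else cp))
    = cm * (x - l1) + c1 * (y - x) + cp * (l2 - y)"
proof -
  have "(LINT s|lborel. indicator {l1..l2} s * (if s < x then cm else if s < y then c1 else cp))
     = (LINT s|lborel. cm * indicator {l1..<x} s + c1 * indicator {x..<y} s + cp * indicator {y..l2} s)"
    using assms by (intro Bochner_Integration.integral_cong) (auto simp: indicator_def)
  also have "\<dots> = (LINT s|lborel. cm * indicator {l1..<x} s) + (LINT s|lborel. c1 * indicator {x..<y} s)
      + (LINT s|lborel. cp * indicator {y..l2} s)"
  proof -
    have "integrable lborel (\<lambda>s. cm * indicator {l1..<x} s)" "integrable lborel (\<lambda>s. c1 * indicator {x..<y} s)"
      "integrable lborel (\<lambda>s. cp * indicator {y..l2} s)"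
      by (intro integrable_mult_right integrable_real_indicator; use assms in simp)+
    then show ?thesis by simp
  qed
  finally show ?thesis using assms by simp
qed

lemma closed_Omega: "closed (Omega L l1 l2)"
proof -
  have "Omega L l1 l2 = {x. - L \<le> x $ 1} \<inter> {x. x $ 1 \<le> L} \<inter> {x. l1 \<le> x $ 2} \<inter> {x. x $ 2 \<le> l2}"
    by (auto simp: Omega_def)
  also have "closed \<dots>"
    by (intro closed_Int closed_Collect_le continuous_intros)
  finally show ?thesis .
qed

text \<open>At time \<open>s\<close> the three regions of the window have the lengths \<open>x * s - l1\<close>, \<open>(y - x) * s\<close> and
  \<open>l2 - y * s\<close>, so that the slice of the integral is affine in \<open>s\<close>.\<close>

lemma fan_integral:
  fixes cm c1 cp :: real
  assumes "0 \<le> t" "0 \<le> L" "x < y" and in_window: "\<And>s. 0 \<le> s \<Longrightarrow> s \<le> t \<Longrightarrow> l1 \<le> x * s \<and> y * s \<le> l2"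
  shows "(LINT p:{0..t} \<times> Omega L l1 l2|lebesgue. fan x y cm c1 cp p)
    = 2 * L * ((l2 * cp - l1 * cm) * t + fan_excess x y cm c1 cp * t\<^sup>2 / 2)"
proof -
  define f where "f p = indicator ({0..t} \<times> Omega L l1 l2) p * fan x y cm c1 cp p" for p
  have meas: "f \<in> borel_measurable borel"
  proof -
    have "{0..t} \<times> Omega L l1 l2 \<in> sets borel"
      by (intro borel_closed closed_Times closed_Omega) auto
    then show ?thesis unfolding f_def by measurable
  qed
  have bound: "\<bar>f p\<bar> \<le> \<bar>cm\<bar> + \<bar>c1\<bar> + \<bar>cp\<bar>" for p
    by (auto simp: f_def fan_def indicator_def split: prod.split)
  define R where "R = t + L + \<bar>l1\<bar> + \<bar>l2\<bar>"
  have supp: "\<bar>s\<bar> \<le> R \<and> \<bar>z $ 1\<bar> \<le> R \<and> \<bar>z $ 2\<bar> \<le> R" if "f (s, z) \<noteq> 0" for s z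
  proof -
    have "0 \<le> s" "s \<le> t" "- L \<le> z $ 1" "z $ 1 \<le> L" "l1 \<le> z $ 2" "z $ 2 \<le> l2"
      using that by (auto simp: f_def Omega_def indicator_def split: if_splits)
    then show ?thesis using assms(1,2) unfolding R_def by linarith
  qed
  define q where "q s = 2 * L * ((l2 * cp - l1 * cm) + fan_excess x y cm c1 cp * s)" for s
  define Q where "Q s = 2 * L * ((l2 * cp - l1 * cm) * s + fan_excess x y cm c1 cp * s\<^sup>2 / 2)" for s
  have slice: "(LINT a|lborel. LINT b|lborel. f (s, vector [a, b])) = q s * indicator {0..t} s" for s
  proof (cases "s \<in> {0..t}")
    case True
    have "x * s \<le> y * s" using True \<open>x < y\<close> by (intro mult_right_mono) auto
    then have "(LINT b|lborel. indicator {l1..l2} b * (if b < x * s then cm else if b < y * s then c1 else cp))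
        = cm * (x * s - l1) + c1 * (y * s - x * s) + cp * (l2 - y * s)"
      using in_window[of s] True by (intro integral_three_step) auto
    also have "\<dots> = (l2 * cp - l1 * cm) + fan_excess x y cm c1 cp * s"
      by (simp add: fan_excess_def algebra_simps)
    finally have inner: "(LINT b|lborel. indicator {l1..l2} b * (if b < x * s then cm else if b < y * s then c1 else cp))
        = (l2 * cp - l1 * cm) + fan_excess x y cm c1 cp * s" .
    have "f (s, vector [a, b]) = indicator {-L..L} a *
        (indicator {l1..l2} b * (if b < x * s then cm else if b < y * s then c1 else cp))" for a b
      using True by (auto simp: f_def fan_def Omega_def indicator_def)
    then show ?thesis using True assms(2) by (simp add: q_def inner)
  next
    case False
    then have "f (s, vector [a, b]) = 0" for a b by (auto simp: f_def indicator_def)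
    then show ?thesis using False by simp
  qed
  have "(LINT p:{0..t} \<times> Omega L l1 l2|lebesgue. fan x y cm c1 cp p) = integral\<^sup>L lebesgue f"
    unfolding set_lebesgue_integral_def f_def by simp
  also have "\<dots> = (LINT s|lborel. q s * indicator {0..t} s)"
    by (subst integral_spacetime_iterated[OF meas bound supp]) (simp_all add: slice)
  also have "\<dots> = Q t - Q 0"
    by (rule integral_FTC_Icc_real)
      (use assms(1) in \<open>auto simp: Q_def q_def intro!: derivative_eq_intros continuous_intros\<close>)
  finally show ?thesis by (simp add: Q_def)
qed

text \<open>What the action and the small-time condition need to know about a solution up to time \<open>T\<close>. Between
  the fronts only the Lagrangian is prescribed, since the velocity of a convex integration solution
  oscillates there.\<close>

definition fan_shaped :: "riemann_data \<Rightarrow> solution \<Rightarrow> real \<Rightarrow> real \<Rightarrow> real \<Rightarrow> real \<Rightarrow> bool" where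
  "fan_shaped D z T x y c1 \<longleftrightarrow> 0 < T \<and> ereal T \<le> lifespan z \<and>
     (\<forall>t q. 0 < t \<longrightarrow> t < T \<longrightarrow> q $ 2 < x * t \<longrightarrow>
        dens z (t, q) = rho_minus D \<and> vel z (t, q) = vert (v_minus D)) \<and>
     (\<forall>t q. 0 < t \<longrightarrow> t < T \<longrightarrow> y * t < q $ 2 \<longrightarrow>
        dens z (t, q) = rho_plus D \<and> vel z (t, q) = vert (v_plus D)) \<and>
     (AE p in lebesgue. 0 < fst p \<longrightarrow> fst p < T \<longrightarrow> x * fst p < snd p $ 2 \<longrightarrow> snd p $ 2 < y * fst p \<longrightarrow>
        lagrangian (dens z p) (vel z p) = c1)"

lemma lagrangian_vert: "lagrangian r (vert a) = r * a\<^sup>2 / 2 - r\<^sup>2"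
  by (simp add: lagrangian_def int_energy_def norm_vec2_sq, simp add: power2_eq_square)

text \<open>The time 1 stands for any positive time, because the two-shock solution is global.\<close>

lemma fan_shaped_two_shock:
  assumes "X < Y"
  shows "fan_shaped D (two_shock D R V X Y) 1 X Y (R * V\<^sup>2 / 2 - R\<^sup>2)"
proof -
  have lt: "X * t < Y * t" if "0 < t" for t using that assms by simp
  show ?thesis
    unfolding fan_shaped_def
  proof (intro conjI allI impI)
    fix t and q :: "real^2"
    assume "0 < t" "Y * t < q $ 2"
    then have "\<not> q $ 2 < X * t" "\<not> q $ 2 < Y * t" using lt[of t] by linarith+
    then show "dens (two_shock D R V X Y) (t, q) = rho_plus D" "vel (two_shock D R V X Y) (t, q) = vert (v_plus D)"
      by (simp_all add: two_shock_def fan_def)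
  next
    show "AE p in lebesgue. 0 < fst p \<longrightarrow> fst p < 1 \<longrightarrow> X * fst p < snd p $ 2 \<longrightarrow> snd p $ 2 < Y * fst p \<longrightarrow>
        lagrangian (dens (two_shock D R V X Y) p) (vel (two_shock D R V X Y) p) = R * V\<^sup>2 / 2 - R\<^sup>2"
      by (intro always_eventually) (auto simp: two_shock_def fan_def lagrangian_vert)
  qed (auto simp: two_shock_def fan_def)
qed

text \<open>The trace of the pointwise constraint: it determines the modulus of an oscillating velocity,
  although not its direction.\<close>

lemma norm_sq_of_pure_state:
  assumes "outer a a - u = mat (C / 2)" and "trace (u :: real^2^2) = 0"
  shows "(norm a)\<^sup>2 = C"
proof -
  have "(a $ i)\<^sup>2 - u $ i $ i = C / 2" for i
    using arg_cong[OF assms(1), of "\<lambda>M. M $ i $ i"] by (simp add: outer_def mat_def power2_eq_square)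
  from this[of 1] this[of 2] show ?thesis
    using assms(2) by (simp add: norm_vec2_sq trace_def sum_2)
qed

text \<open>Taking the part of \<open>mid F\<close> before \<open>T\<close> as lower bound for \<open>\<Lambda>\<close> covers convex integration solutions,
  where \<open>\<Lambda>\<close> is all of \<open>mid F\<close>, and hybrid solutions, where oscillations stop at \<open>T\<close>.\<close>

lemma fan_shaped_perturbation:
  fixes F :: fan_state
  assumes F: "fan_subsolution D F"
    and pert: "perturbation L F \<Lambda> v u"
    and sub: "\<Lambda> \<subseteq> mid F" and sup: "mid F \<inter> {p. fst p < T} \<subseteq> \<Lambda>"
    and T: "0 < T" "ereal T \<le> lifespan z"
    and z: "\<And>p. 0 < fst p \<Longrightarrow> fst p < T \<Longrightarrow> dens z p = fan_rho D F p \<and> vel z p = fan_v D F p + v p"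
  shows "fan_shaped D z T (nu_minus F) (nu_plus F) (rho1 F * CC F / 2 - (rho1 F)\<^sup>2)"
proof -
  let ?x = "nu_minus F" and ?y = "nu_plus F"
  have "?x < ?y" and u1: "u1 F \<in> sym_tracefree" using F by (auto simp: fan_subsolution_def)
  then have lt: "?x * t < ?y * t" if "0 < t" for t using that by simp
  have v0: "v p = 0" if "p \<notin> mid F" for p
    using pert sub that unfolding perturbation_def by blast
  have u: "u p \<in> sym_tracefree" for p using pert unfolding perturbation_def by blast
  have AE: "AE p in lebesgue. p \<in> \<Lambda> \<longrightarrow> outer (v1 F + v p) (v1 F + v p) - (u1 F + u p) = mat (CC F / 2)"
    using pert unfolding perturbation_def by blast
  show ?thesis
    unfolding fan_shaped_def
  proof (intro conjI allI impI)
    fix t and q :: "real^2"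
    assume t: "0 < t" "t < T"
    {
      assume q: "q $ 2 < ?x * t"
      then have "v (t, q) = 0" by (intro v0) (auto simp: mid_def P_mid_def)
      then show "dens z (t, q) = rho_minus D" "vel z (t, q) = vert (v_minus D)"
        using z[of "(t, q)"] t q by (auto simp: fan_rho_def fan_v_def fan_def)
    next
      assume q: "?y * t < q $ 2"
      then have "\<not> q $ 2 < ?x * t" "\<not> q $ 2 < ?y * t" using lt[of t] t by linarith+
      moreover from this have "v (t, q) = 0" by (intro v0) (auto simp: mid_def P_mid_def)
      ultimately show "dens z (t, q) = rho_plus D" "vel z (t, q) = vert (v_plus D)"
        using z[of "(t, q)"] t by (simp_all add: fan_rho_def fan_v_def fan_def)
    }
  next
    show "AE p in lebesgue. 0 < fst p \<longrightarrow> fst p < T \<longrightarrow> ?x * fst p < snd p $ 2 \<longrightarrow> snd p $ 2 < ?y * fst p \<longrightarrow>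
        lagrangian (dens z p) (vel z p) = rho1 F * CC F / 2 - (rho1 F)\<^sup>2"
      using AE
    proof eventually_elim
      case (elim p)
      show ?case
      proof (intro impI)
        assume p: "0 < fst p" "fst p < T" "?x * fst p < snd p $ 2" "snd p $ 2 < ?y * fst p"
        then have "p \<in> mid F \<inter> {p. fst p < T}"
          by (cases p) (auto simp: mid_def P_mid_def)
        then have eq: "outer (v1 F + v p) (v1 F + v p) - (u1 F + u p) = mat (CC F / 2)"
          using elim sup by blast
        have "trace (u1 F + u p) = 0"
          using u1 u[of p] by (simp add: sym_tracefree_def trace_add)
        from norm_sq_of_pure_state[OF eq this]
        have "(norm (v1 F + v p))\<^sup>2 = CC F" .
        moreover have "dens z p = rho1 F" "vel z p = v1 F + v p"
          using z[of p] p by (auto simp: fan_rho_def fan_v_def fan_def split: prod.splits)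
        ultimately show "lagrangian (dens z p) (vel z p) = rho1 F * CC F / 2 - (rho1 F)\<^sup>2"
          by (simp add: lagrangian_def int_energy_def power2_eq_square)
      qed
    qed
  qed (use T in auto)
qed

lemma waves_stay_in_window:
  fixes l1 l2 x y :: real
  assumes "l1 < 0" "0 < l2"
  obtains \<delta> where "0 < \<delta>" "\<And>t. 0 \<le> t \<Longrightarrow> t < \<delta> \<Longrightarrow> l1 < x * t \<and> y * t < l2"
proof
  define M where "M = 1 + \<bar>x\<bar> + \<bar>y\<bar>"
  have "0 < M" by (simp add: M_def)
  then show "0 < min (- l1) l2 / M" using assms by simp
  fix t assume "0 \<le> t" "t < min (- l1) l2 / M"
  then have "M * t < min (- l1) l2" using \<open>0 < M\<close> by (simp add: pos_less_divide_eq mult.commute)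
  moreover have "- x * t \<le> M * t" "y * t \<le> M * t"
    using \<open>0 \<le> t\<close> by (intro mult_right_mono; simp add: M_def)+
  ultimately show "l1 < x * t \<and> y * t < l2" by simp
qed

text \<open>At time \<open>s\<close> the region between the fronts has a length proportional to \<open>s\<close>. Its effect on the integral of the
  Lagrangian over the window is therefore linear in \<open>s\<close> and on the action quadratic in \<open>t\<close>.\<close>

lemma fan_shaped_action:
  assumes fs: "fan_shaped D z T x y c1" and "x < y" "0 \<le> L" "l1 < 0" "0 < l2"
  defines "cm \<equiv> rho_minus D * (v_minus D)\<^sup>2 / 2 - (rho_minus D)\<^sup>2"
    and "cp \<equiv> rho_plus D * (v_plus D)\<^sup>2 / 2 - (rho_plus D)\<^sup>2"
  obtains \<delta> where "0 < \<delta>"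
    and "\<And>t. 0 \<le> t \<Longrightarrow> t < \<delta> \<Longrightarrow> action (Omega L l1 l2) z t
      = 2 * L * (l2 * cp - l1 * cm) * t + 2 * L * fan_excess x y cm c1 cp * t\<^sup>2 / 2"
    and "\<And>t\<^sub>1. t\<^sub>1 \<le> \<delta> \<Longrightarrow> small_time D l1 l2 z t\<^sub>1"
proof -
  obtain d where d: "0 < d" "\<And>t. 0 \<le> t \<Longrightarrow> t < d \<Longrightarrow> l1 < x * t \<and> y * t < l2"
    using waves_stay_in_window[OF assms(4,5)] by blast
  have T: "0 < T" "ereal T \<le> lifespan z"
    and left: "\<And>t q. 0 < t \<Longrightarrow> t < T \<Longrightarrow> q $ 2 < x * t \<Longrightarrow>
        dens z (t, q) = rho_minus D \<and> vel z (t, q) = vert (v_minus D)"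
    and right: "\<And>t q. 0 < t \<Longrightarrow> t < T \<Longrightarrow> y * t < q $ 2 \<Longrightarrow>
        dens z (t, q) = rho_plus D \<and> vel z (t, q) = vert (v_plus D)"
    and middle: "AE p in lebesgue. 0 < fst p \<longrightarrow> fst p < T \<longrightarrow> x * fst p < snd p $ 2 \<longrightarrow> snd p $ 2 < y * fst p \<longrightarrow>
        lagrangian (dens z p) (vel z p) = c1"
    using fs by (auto simp: fan_shaped_def)
  define \<delta> where "\<delta> = min T d"
  have null: "AE p :: spacetime in lebesgue. fst p \<noteq> 0"
  proof -
    have "negligible {p :: spacetime. (1, 0) \<bullet> p = 0}" by (rule negligible_hyperplane) (simp add: zero_prod_def)
    then show ?thesis by (intro AE_I'[of "{p. (1, 0) \<bullet> p = 0}"]) (auto simp: negligible_iff_null_sets inner_prod_def)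
  qed
  show ?thesis
  proof
    show "0 < \<delta>" using T d by (simp add: \<delta>_def)
    show "small_time D l1 l2 z t\<^sub>1" if "t\<^sub>1 \<le> \<delta>" for t\<^sub>1
      unfolding small_time_def
    proof
      have "ereal t\<^sub>1 \<le> ereal T" using that by (simp add: \<delta>_def)
      then show "ereal t\<^sub>1 \<le> lifespan z" using T(2) by (rule order_trans)
      show "AE p in lebesgue. 0 < fst p \<and> fst p < t\<^sub>1 \<and> snd p $ 2 \<notin> {l1<..<l2} \<longrightarrow>
          dens z p = init_rho D (snd p) \<and> vel z p = init_vel D (snd p)"
      proof (intro always_eventually allI impI)
        fix p :: spacetime
        assume p: "0 < fst p \<and> fst p < t\<^sub>1 \<and> snd p $ 2 \<notin> {l1<..<l2}"
        then have *: "0 < fst p" "fst p < T" "l1 < x * fst p" "y * fst p < l2"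
          using that d(2)[of "fst p"] by (auto simp: \<delta>_def)
        show "dens z p = init_rho D (snd p) \<and> vel z p = init_vel D (snd p)"
        proof (cases "snd p $ 2 \<le> l1")
          case True
          then show ?thesis
            using left[of "fst p" "snd p"] * assms(4) by (simp add: init_rho_def init_vel_def)
        next
          case False
          then have "l2 \<le> snd p $ 2" using p by auto
          then show ?thesis
            using right[of "fst p" "snd p"] * assms(5) by (simp add: init_rho_def init_vel_def)
        qed
      qed
    qed
    fix t assume t: "0 \<le> t" "t < \<delta>"
    have "AE p in lebesgue. indicator ({0..t} \<times> Omega L l1 l2) p *\<^sub>R lagrangian (dens z p) (vel z p)
        = indicator ({0..t} \<times> Omega L l1 l2) p *\<^sub>R fan x y cm c1 cp p"
      using middle null AE_not_moving_plane[of x] AE_not_moving_plane[of y]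
    proof eventually_elim
      case (elim p)
      show ?case
      proof (cases "p \<in> {0..t} \<times> Omega L l1 l2")
        case True
        then have p: "0 < fst p" "fst p < T" using elim t by (auto simp: \<delta>_def)
        then have "x * fst p < y * fst p" using \<open>x < y\<close> by simp
        then have "lagrangian (dens z p) (vel z p) = fan x y cm c1 cp p"
          using elim p left[of "fst p" "snd p"] right[of "fst p" "snd p"]
          by (cases p) (auto simp: fan_def lagrangian_vert cm_def cp_def)
        then show ?thesis by simp
      qed simp
    qed
    moreover have "{0..t} \<times> Omega L l1 l2 \<in> sets borel"
      by (intro borel_closed closed_Times closed_Omega) auto
    then have "(\<lambda>p. indicator ({0..t} \<times> Omega L l1 l2) p *\<^sub>R fan x y cm c1 cp p) \<in> borel_measurable borel"
      by measurable
    then have "(\<lambda>p. indicator ({0..t} \<times> Omega L l1 l2) p *\<^sub>R fan x y cm c1 cp p) \<in> borel_measurable lebesgue"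
      by (simp add: measurable_completion)
    ultimately have "action (Omega L l1 l2) z t = (LINT p:{0..t} \<times> Omega L l1 l2|lebesgue. fan x y cm c1 cp p)"
      unfolding action_def set_lebesgue_integral_def by (rule integral_cong_AE_lebesgue)
    also have "\<dots> = 2 * L * ((l2 * cp - l1 * cm) * t + fan_excess x y cm c1 cp * t\<^sup>2 / 2)"
    proof (rule fan_integral[OF t(1) assms(3,2)])
      show "l1 \<le> x * s \<and> y * s \<le> l2" if "0 \<le> s" "s \<le> t" for s
        using d(2)[of s] that t by (simp add: \<delta>_def less_imp_le)
    qed
    finally show "action (Omega L l1 l2) z t
      = 2 * L * (l2 * cp - l1 * cm) * t + 2 * L * fan_excess x y cm c1 cp * t\<^sup>2 / 2"
      by (simp add: algebra_simps)
  qed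
qed


section \<open>Comparison of the actions\<close>

text \<open>A second right derivative at zero presupposes the first one on an interval to the right of zero;
  this is why the quadratic formula has to hold for all small times.\<close>

lemma right_derivatives_quadratic:
  assumes "0 < \<delta>" and f: "\<And>t. 0 \<le> t \<Longrightarrow> t < \<delta> \<Longrightarrow> f t = b * t + c * t\<^sup>2 / 2"
  shows "has_right_derivative0 0 f 0" "has_right_derivative0 1 f b" "has_right_derivative0 2 f c"
proof -
  define g where "g i = (if i = 0 then f else if i = 1 then (\<lambda>t. b + c * t) else (\<lambda>t. c))" for i :: nat
  have "(f has_real_derivative b + c * t) (at t within {t..})" if "0 \<le> t" "t < \<delta>" for t
  proof (rule has_field_derivative_transform_within)
    show "((\<lambda>t. b * t + c * t\<^sup>2 / 2) has_real_derivative b + c * t) (at t within {t..})"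
      by (auto intro!: derivative_eq_intros)
    show "0 < \<delta> - t" using that by simp
    show "b * s + c * s\<^sup>2 / 2 = f s" if "s \<in> {t..}" "dist s t < \<delta> - t" for s
      using that \<open>0 \<le> t\<close> f[of s] by (auto simp: dist_real_def)
  qed simp
  then have d0: "(g 0 has_real_derivative g (Suc 0) t) (at_right t)" if "0 \<le> t" "t < \<delta>" for t
    using that by (simp add: g_def at_within_Ici_at_right)
  have d1: "(g (Suc 0) has_real_derivative g (Suc (Suc 0)) t) (at_right t)" for t
    by (auto simp: g_def intro!: derivative_eq_intros)
  note D = d0[of 0] d1[of 0]
  show "has_right_derivative0 0 f 0"
    unfolding has_right_derivative0_def
    by (intro exI[of _ g] exI[of _ \<delta>]) (use \<open>0 < \<delta>\<close> f[of 0] in \<open>auto simp: g_def\<close>)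
  show "has_right_derivative0 1 f b"
    unfolding has_right_derivative0_def
    by (intro exI[of _ g] exI[of _ \<delta>]) (use \<open>0 < \<delta>\<close> D in \<open>auto simp: g_def\<close>)
  show "has_right_derivative0 2 f c"
    unfolding has_right_derivative0_def
    by (intro exI[of _ g] exI[of _ \<delta>])
      (use \<open>0 < \<delta>\<close> D d0 in \<open>auto simp: less_Suc_eq numeral_2_eq_2, auto simp: g_def\<close>)
qed

theorem theorem5p2:
  fixes D :: riemann_data
    and \<rho>\<^sub>m v\<^sub>m \<nu>\<^sub>m \<nu>\<^sub>p \<rho>\<^sub>s :: real
    and L\<^sub>3 l\<^sub>1 l\<^sub>2 :: real
  assumes "0 < rho_minus D" and "0 < rho_plus D" and "v_plus D < v_minus D"
    and "(v_minus D - v_plus D)\<^sup>2 * rho_plus D * rho_minus D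
         - (rho_plus D - rho_minus D) * (pressure (rho_plus D) - pressure (rho_minus D)) > 0"
    and "is_two_shock D \<rho>\<^sub>m v\<^sub>m \<nu>\<^sub>m \<nu>\<^sub>p"
    and "fan_interval D \<rho>\<^sub>s \<rho>\<^sub>m"
    and "0 < L\<^sub>3" and "l\<^sub>1 < 0" and "0 < l\<^sub>2"
  defines "w \<equiv> two_shock D \<rho>\<^sub>m v\<^sub>m \<nu>\<^sub>m \<nu>\<^sub>p"
  defines "S \<equiv> solution_set L\<^sub>3 D {\<rho>\<^sub>s..\<rho>\<^sub>m} w"
  shows "sARAC_admissible (Omega L\<^sub>3 l\<^sub>1 l\<^sub>2) S w \<and> strictly_LAAP0_admissible D L\<^sub>3 l\<^sub>1 l\<^sub>2 S w"
proof -
  let ?A = "action (Omega L\<^sub>3 l\<^sub>1 l\<^sub>2)"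
  define cm where "cm = rho_minus D * (v_minus D)\<^sup>2 / 2 - (rho_minus D)\<^sup>2"
  define cp where "cp = rho_plus D * (v_plus D)\<^sup>2 / 2 - (rho_plus D)\<^sup>2"
  define b where "b = 2 * L\<^sub>3 * (l\<^sub>2 * cp - l\<^sub>1 * cm)"
  define cw where "cw = 2 * L\<^sub>3 * fan_excess \<nu>\<^sub>m \<nu>\<^sub>p cm (\<rho>\<^sub>m * v\<^sub>m\<^sup>2 / 2 - \<rho>\<^sub>m\<^sup>2) cp"
  have "0 \<le> L\<^sub>3" using assms(7) by simp
  have "\<nu>\<^sub>m < \<nu>\<^sub>p" using assms(5) by (simp add: is_two_shock_def)
  obtain \<delta>w where w: "0 < \<delta>w" "\<And>t. 0 \<le> t \<Longrightarrow> t < \<delta>w \<Longrightarrow> ?A w t = b * t + cw * t\<^sup>2 / 2"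
    "\<And>t\<^sub>1. t\<^sub>1 \<le> \<delta>w \<Longrightarrow> small_time D l\<^sub>1 l\<^sub>2 w t\<^sub>1"
    using fan_shaped_action[OF fan_shaped_two_shock[OF \<open>\<nu>\<^sub>m < \<nu>\<^sub>p\<close>] \<open>\<nu>\<^sub>m < \<nu>\<^sub>p\<close> \<open>0 \<le> L\<^sub>3\<close> assms(8,9)]
    unfolding w_def b_def cw_def cm_def cp_def by metis
  have competitor: "\<exists>\<delta>>0. \<exists>cz>cw. (\<forall>t. 0 \<le> t \<longrightarrow> t < \<delta> \<longrightarrow> ?A z t = b * t + cz * t\<^sup>2 / 2) \<and>
      (\<forall>t\<^sub>1\<le>\<delta>. small_time D l\<^sub>1 l\<^sub>2 z t\<^sub>1)" if "z \<in> S" and new: "\<not> same_solution w z" for z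
  proof -
    have "z \<noteq> w" using new by (auto simp: same_solution_def)
    then obtain F where F: "admissible_fan D F" "rho1 F \<in> {\<rho>\<^sub>s..\<rho>\<^sub>m}" "0 < eps2 F"
      and z: "convex_integration_solution L\<^sub>3 D F z \<or> hybrid_solution L\<^sub>3 D F z"
      using \<open>z \<in> S\<close> by (auto simp: S_def solution_set_def)
    have sub: "fan_subsolution D F" using F(1) by (simp add: admissible_fan_def)
    have nu: "nu_minus F < nu_plus F" and "0 < rho1 F" using sub by (auto simp: fan_subsolution_def)
    let ?c1 = "rho1 F * CC F / 2 - (rho1 F)\<^sup>2"
    from z have "\<exists>T. fan_shaped D z T (nu_minus F) (nu_plus F) ?c1"
    proof
      assume "convex_integration_solution L\<^sub>3 D F z"
      then obtain v u where "perturbation L\<^sub>3 F (mid F) v u"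
        and "z = \<lparr>lifespan = \<infinity>, dens = fan_rho D F, vel = (\<lambda>p. fan_v D F p + v p)\<rparr>"
        by (auto simp: convex_integration_solution_def)
      then have "fan_shaped D z 1 (nu_minus F) (nu_plus F) ?c1"
        by (intro fan_shaped_perturbation[OF sub]) auto
      then show ?thesis ..
    next
      assume "hybrid_solution L\<^sub>3 D F z"
      then obtain T\<^sub>0 T\<^sub>1 v u where "0 < T\<^sub>0" "T\<^sub>0 < T\<^sub>1" "lifespan z = ereal T\<^sub>1"
        "perturbation L\<^sub>3 F (mid F \<inter> {p. fst p < T\<^sub>0}) v u"
        "\<forall>p. 0 < fst p \<and> fst p < T\<^sub>0 \<longrightarrow> dens z p = fan_rho D F p \<and> vel z p = fan_v D F p + v p"
        unfolding hybrid_solution_def by blast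
      then have "fan_shaped D z T\<^sub>0 (nu_minus F) (nu_plus F) ?c1"
        by (intro fan_shaped_perturbation[OF sub]) auto
      then show ?thesis ..
    qed
    then obtain T where fs: "fan_shaped D z T (nu_minus F) (nu_plus F) ?c1" ..
    have "max (rho_minus D) (rho_plus D) < rho1 F"
      using F(2) assms(6) by (auto simp: fan_interval_def)
    then have dens: "rho_minus D < rho1 F" "rho_plus D < rho1 F" "rho1 F \<le> \<rho>\<^sub>m" using F(2) by auto
    \<comment> \<open>The squared speed seen by the balance laws; for the two shocks it is the actual squared speed.\<close>
    have "CC F - eps2 F < CC F" using F(3) by simp
    note fan_excess_two_shock_less[OF dens \<open>0 < rho1 F\<close> nu \<open>\<nu>\<^sub>m < \<nu>\<^sub>p\<close> this
        fan_subsolution_Rankine_Hugoniot[OF sub] two_shock_Rankine_Hugoniot[OF assms(5)]]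
    then have "cw < 2 * L\<^sub>3 * fan_excess (nu_minus F) (nu_plus F) cm ?c1 cp"
      using assms(7) unfolding cw_def cm_def cp_def by simp
    with fan_shaped_action[OF fs nu \<open>0 \<le> L\<^sub>3\<close> assms(8,9)]
    show ?thesis unfolding b_def cm_def cp_def by metis
  qed
  have "w \<in> S" by (simp add: S_def solution_set_def)
  moreover have "\<exists>k. (\<forall>r<k. \<exists>d. has_right_derivative0 r (?A w) d \<and> has_right_derivative0 r (?A z) d) \<and>
      (\<exists>dw dz. has_right_derivative0 k (?A w) dw \<and> has_right_derivative0 k (?A z) dz \<and> dw < dz)"
    if "z \<in> S" "\<not> same_solution w z" for z
  proof -
    obtain \<delta> cz where z: "0 < \<delta>" "cw < cz" "\<And>t. 0 \<le> t \<Longrightarrow> t < \<delta> \<Longrightarrow> ?A z t = b * t + cz * t\<^sup>2 / 2"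
      using competitor[OF \<open>z \<in> S\<close> \<open>\<not> same_solution w z\<close>] by blast
    note dw = right_derivatives_quadratic[OF w(1,2)] and dz = right_derivatives_quadratic[OF z(1,3)]
    have "\<exists>d. has_right_derivative0 r (?A w) d \<and> has_right_derivative0 r (?A z) d" if "r < 2" for r
      using that dw(1,2) dz(1,2) by (auto simp: numeral_2_eq_2 less_Suc_eq)
    with dw(3) dz(3) \<open>cw < cz\<close> show ?thesis by blast
  qed
  moreover have "strictly_preferred_LAAP0 D L\<^sub>3 l\<^sub>1 l\<^sub>2 w z" if "z \<in> S" "\<not> same_solution w z" for z
  proof -
    obtain \<delta> cz where z: "0 < \<delta>" "cw < cz" "\<And>t. 0 \<le> t \<Longrightarrow> t < \<delta> \<Longrightarrow> ?A z t = b * t + cz * t\<^sup>2 / 2"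
      "\<And>t\<^sub>1. t\<^sub>1 \<le> \<delta> \<Longrightarrow> small_time D l\<^sub>1 l\<^sub>2 z t\<^sub>1"
      using competitor[OF \<open>z \<in> S\<close> \<open>\<not> same_solution w z\<close>] by blast
    define t\<^sub>1 where "t\<^sub>1 = min \<delta> \<delta>w"
    have "0 < t\<^sub>1" using z(1) w(1) by (simp add: t\<^sub>1_def)
    have less: "?A w t < ?A z t" if "t \<in> {0<..<t\<^sub>1}" for t
      using that w(2)[of t] z(2) z(3)[of t] by (simp add: t\<^sub>1_def)
    have "t\<^sub>1 / 2 \<in> {0<..<t\<^sub>1}" using \<open>0 < t\<^sub>1\<close> by simp
    moreover have "small_time D l\<^sub>1 l\<^sub>2 w t\<^sub>1" "small_time D l\<^sub>1 l\<^sub>2 z t\<^sub>1"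
      using w(3) z(4) by (simp_all add: t\<^sub>1_def)
    ultimately show ?thesis
      unfolding strictly_preferred_LAAP0_def using less \<open>0 < t\<^sub>1\<close> less_imp_le by metis
  qed
  ultimately show ?thesis
    by (simp add: sARAC_admissible_def strictly_LAAP0_admissible_def)
qed

end
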